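(* Let $Y_n^{(0)}$ and $Y_n^{(1)}$ respectively be the number of nodes of outdegree $0$ and outdegree $1$ of a preferential attachment circuit with index $m$ at time $n$. For $m \ge 2$, as $n\to\infty$, \begin{equation*} \frac{1}{\sqrt n}\left(\begin{pmatrix} Y_n^{(0)} \\ Y_n^{(1)} \end{pmatrix} - \begin{pmatrix} \frac{m + 1}{2m + 1} \\ \frac{m(m + 1)}{(3m + 1)(2m + 1)} \end{pmatrix} n \right) \overset{D}{\longrightarrow} \mathcal{N}_2 \left( \mathbf{0}, \tilde{\mathbf{\Sigma}} \right), \end{equation*} where $$ \tilde{\mathbf{\Sigma}} = \begin{pmatrix} \frac{2m^2(m + 1)}{(3m + 1)(2m + 1)^2} & -\frac{4(m + 1)^2m^2}{(4m + 1)(3m + 1)(2m + 1)^2} \\ -\frac{4(m + 1)^2m^2}{(4m + 1)(3m + 1)(2m + 1)^2} & \frac{2m^2(m + 1)(48m^3 + 59m^2 + 27m + 4)}{(5m + 1)(4m + 1)(3m + 1)^2(2m + 1)^2} \end{pmatrix}. $$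
   Context: A preferential dynamic attachment circuit of index $m$ starts at time $0$ with a single node $0$. At time $n\ge1$ a new node $n$ is added and chooses $m$ parents one at a time, with replacement, from the existing nodes; at each of these $m$ steps an existing node $v$ is chosen with probability proportional to its current outdegree plus one (outdegrees are updated after each of the $m$ choices), and an edge is drawn from the chosen parent to node $n$. $\mathcal{N}_2(\mathbf{0},\tilde{\mathbf{\Sigma}})$ denotes a bivariate normal vector with mean zero and covariance matrix $\tilde{\mathbf{\Sigma}}$. *)

theory Defs
  imports "HOL-Probability.Probability"
begin

(* Outdegree configuration: d v = current outdegree of node v (0 for nodes not yet present). *)

definition pick_parent :: "nat \<Rightarrow> (nat \<Rightarrow> nat) \<Rightarrow> nat pmf" where
  "pick_parent n d = embed_pmf (\<lambda>v. if v < n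
      then real (d v + 1) / (\<Sum>u<n. real (d u + 1)) else 0)"

primrec choose_parents :: "nat \<Rightarrow> nat \<Rightarrow> (nat \<Rightarrow> nat) \<Rightarrow> (nat \<Rightarrow> nat) pmf" where
  "choose_parents n 0 d = return_pmf d"
| "choose_parents n (Suc k) d =
     bind_pmf (pick_parent n d) (\<lambda>v. choose_parents n k (d(v := Suc (d v))))"

(* Outdegree configuration of the preferential dynamic attachment circuit of index m at time n.
   At time 0 only node 0 exists; at time Suc n node Suc n is added and picks m parents among
   the existing nodes 0..n. *)
primrec pa_circuit :: "nat \<Rightarrow> nat \<Rightarrow> (nat \<Rightarrow> nat) pmf" where
  "pa_circuit m 0 = return_pmf (\<lambda>_. 0)"
| "pa_circuit m (Suc n) = bind_pmf (pa_circuit m n) (choose_parents (Suc n) m)"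

definition outdeg_count :: "nat \<Rightarrow> nat \<Rightarrow> (nat \<Rightarrow> nat) \<Rightarrow> nat" where
  "outdeg_count k n d = card {v. v \<le> n \<and> d v = k}"

(* Bivariate normal distribution N_2(0, [[a,b],[b,c]]) for positive definite covariance,
   given by its Lebesgue density on R^2. *)
definition bivariate_normal :: "real \<Rightarrow> real \<Rightarrow> real \<Rightarrow> (real \<times> real) measure" where
  "bivariate_normal a b c =
     density (lborel \<Otimes>\<^sub>M lborel)
       (\<lambda>(x, y). ennreal (exp (- (c * x\<^sup>2 - 2 * b * x * y + a * y\<^sup>2) / (2 * (a * c - b\<^sup>2)))
                          / (2 * pi * sqrt (a * c - b\<^sup>2))))"

definition weak_conv_R2 :: "(nat \<Rightarrow> (real \<times> real) measure) \<Rightarrow> (real \<times> real) measure \<Rightarrow> bool" where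
  "weak_conv_R2 M N \<longleftrightarrow>
     (\<forall>f :: real \<times> real \<Rightarrow> real. continuous_on UNIV f \<and> bounded (range f) \<longrightarrow>
        (\<lambda>n. \<integral>x. f x \<partial>M n) \<longlonglongrightarrow> (\<integral>x. f x \<partial>N))"

end

theory Submission
  imports Defs
begin

text \<open>Follow the circuit after each single parent choice. The centred pair of counts \<open>W = (w1, w2)\<close> then moves by
  bounded jumps whose conditional mean is \<open>A W / S\<close> up to \<open>O(1 / S)\<close>, where \<open>S\<close> is the total weight of the nodes and
  \<open>A = ((-1, 0), (1, -2))\<close>, and whose conditional covariance is a constant form up to \<open>O(|W| / S)\<close>.
  The drift \<open>A\<close> is negative definite, so \<open>E |W|^2\<close> grows at most linearly. Expanding the conditional characteristic
  function of a jump to second order gives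
  \<open>\<phi> (N + 1) \<theta> = \<phi> N (\<theta> + A\<^sup>T \<theta> / S) (1 - v \<theta> / 2) + error\<close> with \<open>v\<close> the limiting jump variance.
  By the Lyapunov equation for the limiting covariance the Gaussian characteristic functions
  \<open>exp (- N / (2 m) * cov_form \<theta>)\<close> satisfy the same recursion. The map \<open>\<theta> \<mapsto> \<theta> + A\<^sup>T \<theta> / S\<close> does not increase the maximum
  norm, so the errors simply add up; for \<open>\<theta>\<close> of order \<open>1 / sqrt n\<close> their sum over \<open>n m\<close> choices tends to \<open>0\<close>.\<close>

text \<open>The recursion closes because the total weight \<open>S\<close> is deterministic: every
  choice adds exactly one outdegree, so the shift of theta depends on \<open>N\<close> alone and
  passes through the expectation. The randomness of \<open>W\<close> enters the errors only through
  its first absolute moment, of order sqrt N. For frequencies of size tau a choice costs an error of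
  order tau^3 + tau / N + tau^2 / sqrt N, which for tau of order 1 / sqrt n sums to order (log n) /
  sqrt n.

  The entries of \<open>A\<close> are the weights 1 and 2 of nodes of outdegree 0 and 1: the former,
  when chosen, pass to the second count, the latter leave both. No covariance is computed along the
  chain; the stated matrix is only verified against the Lyapunov equation. The second moment also
  yields tightness, so that trigonometric approximation leads from characteristic functions to all
  bounded continuous test functions.\<close>

section \<open>Weak convergence in the plane\<close>

text \<open>Levy's continuity theorem in the plane, with tightness as a hypothesis. A trigonometric
  polynomial matches a continuous function only on a box, but it is bounded everywhere; tightness
  makes the mass outside the box, and with it the error there, small uniformly in
  \<open>n\<close>.\<close>

lemma weak_conv_R2I:
  fixes M :: "nat \<Rightarrow> (real \<times> real) measure" and N :: "(real \<times> real) measure"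
  assumes M: "\<And>n. prob_space (M n)" and N: "prob_space N"
    and measM: "\<And>n. (\<lambda>x. x) \<in> measurable (M n) borel" and measN: "(\<lambda>x. x) \<in> measurable N borel"
    and char: "\<And>s t. (\<lambda>n. CLINT x|M n. cis (s * fst x + t * snd x))
                 \<longlonglongrightarrow> (CLINT x|N. cis (s * fst x + t * snd x))"
    and tight: "\<And>e. e > 0 \<Longrightarrow> \<exists>R. \<forall>n. measure (M n) {x \<in> space (M n). R < \<bar>fst x\<bar> \<or> R < \<bar>snd x\<bar>} \<le> e"
  shows "weak_conv_R2 M N"
  unfolding weak_conv_R2_def
proof (intro allI impI, elim conjE)
  fix f :: "real \<times> real \<Rightarrow> real"
  assume cont: "continuous_on UNIV f" and "bounded (range f)"
  then obtain B where B: "\<And>x. \<bar>f x\<bar> \<le> B" "B > 0"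
    unfolding bounded_pos by auto
  note fm = borel_measurable_continuous_onI[OF cont]
  have int: "integrable P h" if "prob_space P" and mP: "(\<lambda>x. x) \<in> measurable P borel" and hm: "h \<in> borel_measurable borel" and bd: "bounded (range h)"
    for P :: "(real \<times> real) measure" and h :: "real \<times> real \<Rightarrow> 'a :: {banach, second_countable_topology}"
  proof -
    interpret prob_space P by fact
    obtain C where "\<And>x. norm (h x) \<le> C" using bd unfolding bounded_pos by auto
    then show ?thesis
      using measurable_compose[OF mP hm] by (intro integrable_const_bound[of _ C]) auto
  qed
  note intM = int[OF M measM] and intN = int[OF N measN]
  \<comment> \<open>Asking for convergence at every frequency makes \<open>T\<close> closed under
    multiplication by any \<open>cis\<close>, hence by sines of the coordinates. Frequency 0 gives
    back the convergence of the integrals of \<open>h\<close>.\<close>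
  define T :: "(real \<times> real \<Rightarrow> complex) set" where
    "T = {h. h \<in> borel_measurable borel \<and> bounded (range h) \<and>
       (\<forall>s t. (\<lambda>n. CLINT x|M n. h x * cis (s * fst x + t * snd x)) \<longlonglongrightarrow> (CLINT x|N. h x * cis (s * fst x + t * snd x)))}"
  have cism: "(\<lambda>x::real \<times> real. cis (s * fst x + t * snd x)) \<in> borel_measurable borel" for s t
    by (intro borel_measurable_continuous_onI continuous_intros)
  have T_mul_bd: "bounded (range (\<lambda>x. h x * cis (s * fst x + t * snd x)))" if "h \<in> T" for h s t
    using that unfolding T_def bounded_iff by (auto simp: norm_mult)
  have T_one: "(\<lambda>_. 1) \<in> T"
    using char by (auto simp: T_def)
  have T_cmul: "(\<lambda>x. c * h x) \<in> T" if "h \<in> T" for c h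
  proof -
    have "bounded (range (\<lambda>x. c * h x))"
      using that bounded_scaling[of "range h"] by (auto simp: T_def bounded_iff norm_mult) (metis mult_left_mono norm_ge_zero)
    moreover have "(\<lambda>n. c * (CLINT x|M n. h x * cis (s * fst x + t * snd x))) \<longlonglongrightarrow> c * (CLINT x|N. h x * cis (s * fst x + t * snd x))" for s t
      using that by (intro tendsto_intros) (auto simp: T_def)
    ultimately show ?thesis using that by (auto simp: T_def mult.assoc)
  qed
  have T_add: "(\<lambda>x. g x + h x) \<in> T" if "g \<in> T" "h \<in> T" for g h
  proof -
    have mm: "(\<lambda>x. h x * cis (s * fst x + t * snd x)) \<in> borel_measurable borel" if "h \<in> T" for h s t
      using that cism by (auto simp: T_def intro!: borel_measurable_times)
    have "bounded (range (\<lambda>x. g x + h x))"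
      using bounded_plus_comp[of g UNIV h] that by (auto simp: T_def)
    moreover have "(\<lambda>n. CLINT x|M n. (g x + h x) * cis (s * fst x + t * snd x)) \<longlonglongrightarrow> (CLINT x|N. (g x + h x) * cis (s * fst x + t * snd x))" for s t
    proof -
      have "(\<lambda>n. (CLINT x|M n. g x * cis (s * fst x + t * snd x)) + (CLINT x|M n. h x * cis (s * fst x + t * snd x)))
         \<longlonglongrightarrow> (CLINT x|N. g x * cis (s * fst x + t * snd x)) + (CLINT x|N. h x * cis (s * fst x + t * snd x))"
        using that by (intro tendsto_intros) (auto simp: T_def)
      then show ?thesis
        using intM[OF mm T_mul_bd] intN[OF mm T_mul_bd] that by (simp add: distrib_right)
    qed
    ultimately show ?thesis using that by (auto simp: T_def)
  qed
  have T_cis: "(\<lambda>x. cis (s * fst x + t * snd x) * h x) \<in> T" if "h \<in> T" for s t h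
  proof -
    have e: "cis (s * fst x + t * snd x) * h x * cis (s' * fst x + t' * snd x)
       = h x * cis ((s + s') * fst x + (t + t') * snd x)" for s' t' x
      by (simp add: cis_mult[symmetric] algebra_simps)
    have "bounded (range (\<lambda>x. cis (s * fst x + t * snd x) * h x))"
      using T_mul_bd[OF that, of s t] by (simp add: mult.commute)
    then show ?thesis using that cism unfolding T_def mem_Collect_eq e
      by (intro conjI allI borel_measurable_times; simp)
  qed
  have T_sin1: "(\<lambda>x. complex_of_real (sin (c * fst x)) * h x) \<in> T" if "h \<in> T" for c h
  proof -
    have e: "complex_of_real (sin y) * z = (-\<i>/2) * (cis y * z) + (\<i>/2) * (cis (-y) * z)" for y z
      by (auto simp: complex_eq_iff field_simps)
    show ?thesis
      using T_add[OF T_cmul[OF T_cis[OF that, of c 0]] T_cmul[OF T_cis[OF that, of "-c" 0]], of "-\<i>/2" "\<i>/2"]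
      by (simp add: e)
  qed
  have T_sin2: "(\<lambda>x. complex_of_real (sin (c * snd x)) * h x) \<in> T" if "h \<in> T" for c h
  proof -
    have e: "complex_of_real (sin y) * z = (-\<i>/2) * (cis y * z) + (\<i>/2) * (cis (-y) * z)" for y z
      by (auto simp: complex_eq_iff field_simps)
    show ?thesis
      using T_add[OF T_cmul[OF T_cis[OF that, of 0 c]] T_cmul[OF T_cis[OF that, of 0 "-c"]], of "-\<i>/2" "\<i>/2"]
      by (simp add: e)
  qed
  \<comment> \<open>The factor \<open>h\<close> stays arbitrary because \<open>T\<close> is not
    known to be closed under products: in the product case the hypothesis for \<open>f\<close> is
    applied to \<open>g\<close> times \<open>h\<close>.\<close>
  have T_poly: "(\<lambda>x. complex_of_real (p (sin (c * fst x), sin (c * snd x))) * h x) \<in> T"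
    if "real_polynomial_function p" "h \<in> T" for p :: "real \<times> real \<Rightarrow> real" and c h
    using that
  proof (induction p arbitrary: h rule: real_polynomial_function.induct)
    case (linear l)
    then interpret l: bounded_linear l by simp
    have uv: "(u, v) = u *\<^sub>R (1::real, 0) + v *\<^sub>R (0, 1::real)" for u v :: real by simp
    define a b where "a = l (1, 0)" and "b = l (0, 1)"
    have e: "l (u, v) = u * a + v * b" for u v
      unfolding a_def b_def by (metis uv l.add l.scaleR real_scaleR_def)
    show ?case
      using T_add[OF T_cmul[OF T_sin1[OF linear(2), of c], of a] T_cmul[OF T_sin2[OF linear(2), of c], of b]]
      by (simp add: e algebra_simps)
  next
    case (const a)
    then show ?case using T_cmul by auto
  next
    case (add f g)
    then show ?case using T_add[OF add.IH(1) add.IH(2)] by (simp add: distrib_right)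
  next
    case (mult f g)
    then show ?case using mult.IH(1)[OF mult.IH(2)] by (simp add: mult.assoc)
  qed
  show "(\<lambda>n. \<integral>x. f x \<partial>M n) \<longlonglongrightarrow> (\<integral>x. f x \<partial>N)"
  proof (rule LIMSEQ_I)
    fix e :: real assume "e > 0"
    \<comment> \<open>Replacing \<open>f\<close> by the approximation costs at most
      \<open>d + (2 * B + d) * d\<close> under each measure; \<open>d \<le> 1\<close> bounds this by
      \<open>d * (2 + 2 * B)\<close>, at most a fifth of \<open>e\<close>. The final comparison
      spends three such fifths.\<close>
    define d where "d = min 1 (e / (5 * (2 + 2 * B)))"
    have d: "d > 0" "d \<le> 1" "d * (2 + 2 * B) \<le> e / 5"
    proof -
      show "d > 0" "d \<le> 1" using \<open>e > 0\<close> \<open>B > 0\<close> by (auto simp: d_def)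
      have "d * (2 + 2 * B) \<le> e / (5 * (2 + 2 * B)) * (2 + 2 * B)"
        using \<open>B > 0\<close> by (intro mult_right_mono) (auto simp: d_def)
      also have "e / (5 * (2 + 2 * B)) * (2 + 2 * B) = e / 5"
      proof -
        have "e / (5 * q) * q = e / 5" if "q > 0" for q using that by simp
        then show ?thesis using \<open>B > 0\<close> by (metis add_pos_pos mult_pos_pos zero_less_numeral)
      qed
      finally show "d * (2 + 2 * B) \<le> e / 5" .
    qed
    interpret N: prob_space N by fact
    obtain R1 where R1: "\<And>n. measure (M n) {x \<in> space (M n). R1 < \<bar>fst x\<bar> \<or> R1 < \<bar>snd x\<bar>} \<le> d"
      using tight[OF d(1)] by auto
    define A where "A r x \<longleftrightarrow> r < \<bar>fst x\<bar> \<or> r < \<bar>snd x\<bar>" for r and x :: "real \<times> real"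
    have meas: "{x \<in> space P. A r x} \<in> sets P" if "(\<lambda>x. x) \<in> measurable P borel" for P r
    proof -
      have "open {x. A r x}"
        unfolding A_def by (intro open_Collect_disj open_Collect_less continuous_intros)
      then have "{x. A r x} \<in> sets borel" by auto
      from measurable_sets[OF that this] show ?thesis by (simp add: vimage_def Int_def conj_commute)
    qed
    have "(\<lambda>k. measure N {x \<in> space N. A (real k) x}) \<longlonglongrightarrow> measure N (\<Inter>k. {x \<in> space N. A (real k) x})"
      using meas[OF measN] by (intro N.finite_Lim_measure_decseq) (auto simp: decseq_def A_def)
    moreover have "(\<Inter>k. {x \<in> space N. A (real k) x}) = {}"
    proof -
      have "\<not> A (real (nat \<lceil>max \<bar>fst x\<bar> \<bar>snd x\<bar>\<rceil>)) x" for x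
        unfolding A_def by linarith
      then show ?thesis by blast
    qed
    ultimately have "(\<lambda>k. measure N {x \<in> space N. A (real k) x}) \<longlonglongrightarrow> 0" by simp
    from order_tendstoD(2)[OF this d(1)] obtain k where k: "measure N {x \<in> space N. A (real k) x} < d"
      by (auto simp: eventually_sequentially)
    define R where "R = Max {1, R1, real k}"
    have R: "R \<ge> 1" "R \<ge> R1" "R \<ge> real k" by (auto simp: R_def)
    interpret M: prob_space "M n" for n by (rule M)
    have AM: "measure (M n) {x \<in> space (M n). A R x} \<le> d" for n
    proof -
      have "measure (M n) {x \<in> space (M n). A R x} \<le> measure (M n) {x \<in> space (M n). A R1 x}"
        using R meas[OF measM] by (intro M.finite_measure_mono) (auto simp: A_def)
      with R1[of n] show ?thesis by (auto simp: A_def)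
    qed
    have AN: "measure N {x \<in> space N. A R x} \<le> d"
    proof -
      have "measure N {x \<in> space N. A R x} \<le> measure N {x \<in> space N. A (real k) x}"
        using R meas[OF measN] by (intro N.finite_measure_mono) (auto simp: A_def)
      with k show ?thesis by auto
    qed
    \<comment> \<open>Approximating \<open>f\<close> in the coordinates \<open>sin (x / R)\<close>, \<open>sin (y / R)\<close> by a polynomial yields a trigonometric
      polynomial, which is close to \<open>f\<close> on the box of radius \<open>R\<close> and bounded by \<open>B + d\<close> everywhere.\<close>
    have "continuous_on ({-1..1} \<times> {-1..1}) (\<lambda>x. f (R * arcsin (fst x), R * arcsin (snd x)))"
      by (rule continuous_on_compose2[OF cont]) (auto intro!: continuous_intros)
    from Stone_Weierstrass_real_polynomial_function[OF _ this d(1)]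
    obtain p where p: "real_polynomial_function p"
      and pf: "\<And>x. x \<in> {-1..1} \<times> {-1..1} \<Longrightarrow> \<bar>f (R * arcsin (fst x), R * arcsin (snd x)) - p x\<bar> < d"
      by (metis compact_Icc compact_Times)
    define g where "g x = p (sin (1 / R * fst x), sin (1 / R * snd x))" for x
    have gB: "\<bar>g x\<bar> \<le> B + d" for x
      using pf[of "(sin (1 / R * fst x), sin (1 / R * snd x))"]
        B(1)[of "(R * arcsin (sin (1 / R * fst x)), R * arcsin (sin (1 / R * snd x)))"]
      unfolding g_def by auto
    have fg: "\<bar>f x - g x\<bar> \<le> d" if "\<not> A R x" for x
    proof -
      have "\<bar>y / R\<bar> \<le> pi / 2" if "\<bar>y\<bar> \<le> R" for y
      proof -
        have "\<bar>y / R\<bar> \<le> 1" using that R by (simp add: field_simps)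
        with pi_ge_two show ?thesis by linarith
      qed
      then have "\<bar>fst x / R\<bar> \<le> pi / 2" "\<bar>snd x / R\<bar> \<le> pi / 2" using that by (auto simp: A_def)
      then have "arcsin (sin (fst x / R)) = fst x / R" "arcsin (sin (snd x / R)) = snd x / R"
        by (intro arcsin_sin; linarith)+
      then show ?thesis
        using pf[of "(sin (1 / R * fst x), sin (1 / R * snd x))"] R unfolding g_def by simp
    qed
    have gT: "(\<lambda>x. complex_of_real (g x)) \<in> T"
      using T_poly[OF p T_one, of "1 / R"] by (simp add: g_def)
    have gm: "g \<in> borel_measurable borel"
    proof -
      have "(\<lambda>x. Re (complex_of_real (g x))) \<in> borel_measurable borel"
        using gT by (intro measurable_compose[OF _ borel_measurable_continuous_onI[OF continuous_on_Re[OF continuous_on_id]]])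
          (auto simp: T_def)
      then show ?thesis by simp
    qed
    have gb: "bounded (range g)" using gB unfolding bounded_iff by auto
    have diff: "\<bar>(\<integral>x. f x \<partial>P) - (\<integral>x. g x \<partial>P)\<bar> \<le> e / 5"
      if "prob_space P" "(\<lambda>x. x) \<in> measurable P borel" "measure P {x \<in> space P. A R x} \<le> d" for P
    proof -
      interpret P: prob_space P by fact
      note iP = int[OF that(1,2)]
      have [simp]: "integrable P f" "integrable P g"
        using iP[OF fm \<open>bounded (range f)\<close>] iP[OF gm gb] by auto
      have [simp]: "integrable P (indicator {x \<in> space P. A R x} :: _ \<Rightarrow> real)"
        using meas[OF that(2)] by (simp add: P.emeasure_eq_measure)
      have "\<bar>(\<integral>x. f x \<partial>P) - (\<integral>x. g x \<partial>P)\<bar> = \<bar>\<integral>x. f x - g x \<partial>P\<bar>"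
        by simp
      also have "\<dots> \<le> (\<integral>x. \<bar>f x - g x\<bar> \<partial>P)"
        by (rule integral_abs_bound)
      also have "\<dots> \<le> (\<integral>x. d + (2 * B + d) * indicator {x \<in> space P. A R x} x \<partial>P)"
      proof (rule integral_mono)
        fix x assume "x \<in> space P"
        show "\<bar>f x - g x\<bar> \<le> d + (2 * B + d) * indicator {x \<in> space P. A R x} x"
          using fg[of x] B(1)[of x] gB[of x] d \<open>x \<in> space P\<close> by (cases "A R x") auto
      qed auto
      also have "\<dots> = d + (2 * B + d) * measure P {x \<in> space P. A R x}"
      proof -
        have "{x \<in> space P. A R x} \<inter> space P = {x \<in> space P. A R x}" by auto
        then show ?thesis by (simp add: P.prob_space)
      qed
      also have "\<dots> \<le> d + (2 * B + 1) * d"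
        using that(3) d B(2) by (intro add_left_mono mult_mono) auto
      also have "\<dots> \<le> e / 5" using d(3) by (simp add: algebra_simps)
      finally show ?thesis .
    qed
    have "(\<lambda>n. CLINT x|M n. complex_of_real (g x)) \<longlonglongrightarrow> (CLINT x|N. complex_of_real (g x))"
      using gT unfolding T_def by (auto dest!: spec[of _ 0])
    from tendsto_Re[OF this] have "(\<lambda>n. \<integral>x. g x \<partial>M n) \<longlonglongrightarrow> (\<integral>x. g x \<partial>N)" by simp
    from LIMSEQ_D[OF this, of "e / 5"] \<open>e > 0\<close> obtain n0
      where n0: "\<And>n. n \<ge> n0 \<Longrightarrow> \<bar>(\<integral>x. g x \<partial>M n) - (\<integral>x. g x \<partial>N)\<bar> < e / 5" by auto
    show "\<exists>n0. \<forall>n\<ge>n0. norm ((\<integral>x. f x \<partial>M n) - (\<integral>x. f x \<partial>N)) < e"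
    proof (intro exI allI impI)
      fix n assume "n \<ge> n0"
      show "norm ((\<integral>x. f x \<partial>M n) - (\<integral>x. f x \<partial>N)) < e"
        using n0[OF \<open>n \<ge> n0\<close>] diff[OF M measM AM, of n] diff[OF N measN AN] \<open>e > 0\<close>
        unfolding real_norm_def by linarith
    qed
  qed
qed

section \<open>Characteristic functions of normal laws on the line and in the plane\<close>

lemma normal_char:
  assumes "\<sigma> > 0"
  shows "(CLINT x|lborel. normal_density \<mu> \<sigma> x *\<^sub>R cis (t * x)) = complex_of_real (exp (- (\<sigma>\<^sup>2 * t\<^sup>2) / 2)) * cis (t * \<mu>)"
proof -
  have "(CLINT x|lborel. normal_density \<mu> \<sigma> x *\<^sub>R cis (t * x))
      = \<sigma> *\<^sub>R (CLINT x|lborel. normal_density \<mu> \<sigma> (\<mu> + \<sigma> * x) *\<^sub>R cis (t * (\<mu> + \<sigma> * x)))"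
    using assms by (subst lborel_integral_real_affine[of \<sigma> _ \<mu>]) auto
  also have "\<dots> = (CLINT x|lborel. cis (t * \<mu>) * (std_normal_density x *\<^sub>R iexp ((t * \<sigma>) * x)))"
  proof -
    have "\<sigma> *\<^sub>R (normal_density \<mu> \<sigma> (\<mu> + \<sigma> * x) *\<^sub>R cis (t * (\<mu> + \<sigma> * x)))
      = cis (t * \<mu>) * (std_normal_density x *\<^sub>R iexp ((t * \<sigma>) * x))" for x
    proof -
      have "\<sigma> * normal_density \<mu> \<sigma> (\<mu> + \<sigma> * x) = std_normal_density x"
        using assms by (simp add: normal_density_def real_sqrt_mult power_mult_distrib)
      moreover have "cis (t * (\<mu> + \<sigma> * x)) = cis (t * \<mu>) * iexp ((t * \<sigma>) * x)"
        by (simp only: cis_conv_exp exp_add[symmetric]) (simp add: algebra_simps)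
      ultimately show ?thesis by simp
    qed
    then show ?thesis by (simp only: integral_scaleR_right[symmetric])
  qed
  also have "\<dots> = cis (t * \<mu>) * char std_normal_distribution (t * \<sigma>)"
    by (simp add: char_def integral_density del: mult_scaleR_right)
  finally show ?thesis
    by (simp add: char_std_normal_distribution power_mult_distrib mult.commute)
qed

text \<open>Completing the square in \<open>y\<close> disintegrates the law along its first
  coordinate, which is normal with variance \<open>a\<close>; given its value \<open>x\<close>, the
  second is normal with mean \<open>b * x / a\<close> and variance
  \<open>(a * c - b\<^sup>2) / a\<close>. The scale argument of \<open>normal_density\<close> is a
  standard deviation, hence the square roots.\<close>

lemma bivariate_normal_density_factor:
  fixes a b c x y :: real
  assumes "a > 0" "a * c - b\<^sup>2 > 0"
  shows "exp (- (c * x\<^sup>2 - 2 * b * x * y + a * y\<^sup>2) / (2 * (a * c - b\<^sup>2))) / (2 * pi * sqrt (a * c - b\<^sup>2))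
     = normal_density 0 (sqrt a) x * normal_density (b * x / a) (sqrt ((a * c - b\<^sup>2) / a)) y"
proof -
  define D where "D = a * c - b\<^sup>2"
  have D: "D > 0" using assms by (simp add: D_def)
  have c: "c = (D + b\<^sup>2) / a" using assms by (simp add: D_def)
  have eq1: "- (c * x\<^sup>2 - 2 * b * x * y + a * y\<^sup>2) / (2 * D)
     = - (x\<^sup>2) / (2 * a) + - ((y - b * x / a)\<^sup>2) / (2 * (D / a))"
    unfolding c using D assms(1) by (simp add: field_simps power2_eq_square)
  have eq2: "2 * pi * sqrt D = sqrt (2 * pi * a) * sqrt (2 * pi * (D / a))"
  proof -
    have "2 * pi * a * (2 * pi * (D / a)) = (2 * pi)\<^sup>2 * D"
      using assms(1) by (simp add: power2_eq_square)
    then have "sqrt (2 * pi * a) * sqrt (2 * pi * (D / a)) = sqrt ((2 * pi)\<^sup>2 * D)"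
      by (simp only: real_sqrt_mult[symmetric])
    then show ?thesis by (simp add: real_sqrt_mult)
  qed
  show ?thesis
    unfolding normal_density_def D_def[symmetric] eq1 eq2 exp_add using D assms(1) by simp
qed

lemma
  assumes "a > 0" "a * c - b\<^sup>2 > 0"
  shows prob_space_bivariate_normal: "prob_space (bivariate_normal a b c)"
    and bivariate_normal_char: "(CLINT x|bivariate_normal a b c. cis (s * fst x + t * snd x))
      = complex_of_real (exp (- (a * s\<^sup>2 + 2 * b * s * t + c * t\<^sup>2) / 2))"
proof -
  define D where "D = a * c - b\<^sup>2"
  have D: "D > 0" using assms by (simp add: D_def)
  define f where "f x = normal_density 0 (sqrt a) x" for x
  define g where "g x y = normal_density (b * x / a) (sqrt (D / a)) y" for x y
  have fgn: "f x \<ge> 0" "g x y \<ge> 0" for x y by (auto simp: f_def g_def)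
  have [measurable]: "f \<in> borel_measurable borel" "(\<lambda>(x, y). g x y) \<in> borel_measurable (lborel \<Otimes>\<^sub>M lborel)"
     "(\<lambda>x. g (fst x) (snd x)) \<in> borel_measurable (lborel \<Otimes>\<^sub>M lborel)"
    unfolding f_def g_def normal_density_def by measurable
  have [measurable]: "(\<lambda>x. cis (s * fst x + t * snd x)) \<in> borel_measurable (lborel \<Otimes>\<^sub>M lborel)"
    unfolding lborel_prod measurable_lborel2
    by (intro borel_measurable_continuous_onI continuous_intros)
  have bn: "bivariate_normal a b c = density (lborel \<Otimes>\<^sub>M lborel) (\<lambda>x. ennreal (f (fst x) * g (fst x) (snd x)))"
    unfolding bivariate_normal_def f_def g_def
    by (simp only: split_beta' bivariate_normal_density_factor[OF assms] D_def)
  have one: "(\<integral>\<^sup>+y. normal_density \<mu> \<sigma> y \<partial>lborel) = 1" if "\<sigma> > 0" for \<mu> \<sigma>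
    using that by (subst nn_integral_eq_integral) auto
  have "emeasure (bivariate_normal a b c) (space (bivariate_normal a b c)) =
     (\<integral>\<^sup>+x. ennreal (f (fst x) * g (fst x) (snd x)) \<partial>(lborel \<Otimes>\<^sub>M lborel))"
    unfolding bn space_density by (subst emeasure_density[OF _ sets.top]) (auto simp: space_pair_measure intro!: nn_integral_cong)
  also have "\<dots> = (\<integral>\<^sup>+x. \<integral>\<^sup>+y. ennreal (f x * g x y) \<partial>lborel \<partial>lborel)"
    by (subst lborel.nn_integral_fst[symmetric]) auto
  also have "\<dots> = (\<integral>\<^sup>+x. ennreal (f x) * (\<integral>\<^sup>+y. ennreal (g x y) \<partial>lborel) \<partial>lborel)"
    using fgn by (auto simp: ennreal_mult g_def intro!: nn_integral_cong nn_integral_cmult)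
  also have "\<dots> = 1"
    using D assms by (simp add: f_def g_def one)
  finally show P: "prob_space (bivariate_normal a b c)" by (rule prob_spaceI)
  define h where "h x = (f (fst x) * g (fst x) (snd x)) *\<^sub>R cis (s * fst x + t * snd x)" for x
  have hm: "h \<in> borel_measurable (lborel \<Otimes>\<^sub>M lborel)"
    unfolding h_def by measurable
  have "integrable (bivariate_normal a b c) (\<lambda>x. cis (s * fst x + t * snd x))"
  proof -
    interpret prob_space "bivariate_normal a b c" by fact
    show ?thesis
      by (intro integrable_const_bound[of _ 1]) (auto simp: bn)
  qed
  then have int: "integrable (lborel \<Otimes>\<^sub>M lborel) (\<lambda>(x, y). h (x, y))"
    unfolding bn h_def
    by (subst (asm) integrable_density)
      (use fgn in \<open>auto simp: split_beta'\<close>)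
  have "(CLINT x|bivariate_normal a b c. cis (s * fst x + t * snd x)) = (CLINT x|lborel \<Otimes>\<^sub>M lborel. h x)"
    unfolding bn h_def
    by (subst integral_density)
      (use fgn in auto)
  also have "\<dots> = (CLINT x|lborel. CLINT y|lborel. h (x, y))"
    using lborel_pair.integral_fst'[of h] int by (simp add: split_beta')
  \<comment> \<open>The conditional mean \<open>b * x / a\<close> contributes the phase
    \<open>t * (b * x / a)\<close>, so what remains is a one-dimensional characteristic function at
    frequency \<open>s + t * b / a\<close>.\<close>
  also have "\<dots> = (CLINT x|lborel. complex_of_real (exp (- (D / a * t\<^sup>2) / 2)) * (f x *\<^sub>R cis ((s + t * b / a) * x)))"
  proof (rule Bochner_Integration.integral_cong)
    fix x
    have "(CLINT y|lborel. h (x, y)) = (CLINT y|lborel. (f x *\<^sub>R cis (s * x)) * (g x y *\<^sub>R cis (t * y)))"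
      by (simp add: h_def cis_mult[symmetric] scaleR_conv_of_real mult_ac)
    also have "\<dots> = (f x *\<^sub>R cis (s * x)) * (CLINT y|lborel. g x y *\<^sub>R cis (t * y))"
      by (rule integral_mult_right_zero)
    also have "\<dots> = f x *\<^sub>R cis (s * x) * (complex_of_real (exp (- (D / a * t\<^sup>2) / 2)) * cis (t * (b * x / a)))"
      using D assms by (simp add: g_def normal_char)
    also have "\<dots> = complex_of_real (exp (- (D / a * t\<^sup>2) / 2)) * (f x *\<^sub>R cis ((s + t * b / a) * x))"
      by (simp add: cis_mult scaleR_conv_of_real mult_ac algebra_simps)
    finally show "(CLINT y|lborel. h (x, y)) = complex_of_real (exp (- (D / a * t\<^sup>2) / 2)) * (f x *\<^sub>R cis ((s + t * b / a) * x))" .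
  qed simp
  also have "\<dots> = complex_of_real (exp (- (D / a * t\<^sup>2) / 2)) * complex_of_real (exp (- (a * (s + t * b / a)\<^sup>2) / 2))"
    using assms by (subst integral_mult_right_zero) (simp add: f_def normal_char)
  also have "\<dots> = complex_of_real (exp (- (D / a * t\<^sup>2) / 2 + - (a * (s + t * b / a)\<^sup>2) / 2))"
    by (simp only: exp_add of_real_mult)
  also have "- (D / a * t\<^sup>2) / 2 + - (a * (s + t * b / a)\<^sup>2) / 2 = - (a * s\<^sup>2 + 2 * b * s * t + c * t\<^sup>2) / 2"
    using assms by (simp add: D_def field_simps power2_eq_square)
  finally show "(CLINT x|bivariate_normal a b c. cis (s * fst x + t * snd x))
      = complex_of_real (exp (- (a * s\<^sup>2 + 2 * b * s * t + c * t\<^sup>2) / 2))" .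
qed

section \<open>Estimates for one parent choice\<close>

lemma norm_cis_approx:
  shows "norm (cis x - 1) \<le> \<bar>x\<bar>"
    and "norm (cis x - (1 + \<i> * x)) \<le> x\<^sup>2 / 2"
    and "norm (cis x - (1 + \<i> * x - x\<^sup>2 / 2)) \<le> \<bar>x\<bar> ^ 3 / 6"
  using iexp_approx1[of x 0] iexp_approx1[of x 1] iexp_approx1[of x 2]
  by (simp_all add: cis_conv_exp eval_nat_numeral algebra_simps power2_eq_square)

text \<open>The variance of s X + t Y for a jump (X, Y) that is (-1, 1) with probability
  \<open>p0\<close>, (0, -1) with probability \<open>p1\<close> and (0, 0) otherwise: these are the
  effects of choosing a parent of outdegree 0, 1 or more.\<close>

definition step_variance :: "real \<Rightarrow> real \<Rightarrow> real \<Rightarrow> real \<Rightarrow> real" where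
  "step_variance p0 p1 s t = p0 * (t - s)\<^sup>2 + p1 * t\<^sup>2 - (p0 * (t - s) - p1 * t)\<^sup>2"

text \<open>A variance is the sum of p_i p_j (x_i - x_j)^2 over pairs of outcomes, here with the
  values \<open>t - s\<close>, \<open>- t\<close> and 0; the upper bound is that of the second
  moment. For \<open>\<tau> \<le> 1\<close> the two put
  \<open>1 - step_variance p0 p1 s t / 2\<close> in [-1, 1].\<close>

lemma step_variance_bounds:
  assumes "0 \<le> p0" "0 \<le> p1" "p0 + p1 \<le> 1" "\<bar>s\<bar> \<le> \<tau>" "\<bar>t\<bar> \<le> \<tau>"
  shows "0 \<le> step_variance p0 p1 s t" "step_variance p0 p1 s t \<le> 4 * \<tau>\<^sup>2"
proof -
  have "step_variance p0 p1 s t = p0 * (1 - p0 - p1) * (t - s)\<^sup>2 + p1 * (1 - p0 - p1) * t\<^sup>2 + p0 * p1 * (2 * t - s)\<^sup>2"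
    unfolding step_variance_def by (simp add: power2_eq_square algebra_simps)
  then show "0 \<le> step_variance p0 p1 s t" using assms by simp
  have "(t - s)\<^sup>2 \<le> (2 * \<tau>)\<^sup>2" "t\<^sup>2 \<le> (2 * \<tau>)\<^sup>2"
    by (rule abs_le_square_iff[THEN iffD1], use assms in simp)+
  then have "p0 * (t - s)\<^sup>2 + p1 * t\<^sup>2 \<le> p0 * (2 * \<tau>)\<^sup>2 + p1 * (2 * \<tau>)\<^sup>2"
    using assms by (intro add_mono mult_left_mono)
  also have "\<dots> = (p0 + p1) * (2 * \<tau>)\<^sup>2" by (simp add: algebra_simps)
  also have "\<dots> \<le> 1 * (2 * \<tau>)\<^sup>2" using assms by (intro mult_right_mono) auto
  also have "\<dots> = 4 * \<tau>\<^sup>2" by (simp add: power_mult_distrib)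
  finally show "step_variance p0 p1 s t \<le> 4 * \<tau>\<^sup>2"
    unfolding step_variance_def using zero_le_power2[of "p0 * (t - s) - p1 * t"] by linarith
qed

text \<open>One parent choice. A node of outdegree \<open>0\<close> is chosen with probability \<open>P0\<close>, one of outdegree \<open>1\<close> with
  probability \<open>P1\<close>; \<open>w1\<close>, \<open>w2\<close> are the centred counts of these nodes, \<open>p0\<close>, \<open>p1\<close> the limits of \<open>P0\<close>, \<open>P1\<close>, and
  \<open>S\<close> is the total weight of all nodes.\<close>
locale urn_step =
  fixes S p0 p1 P0 P1 e0 e1 w1 w2 :: real
  assumes S: "S \<ge> 1"
    and p: "0 \<le> p0" "0 \<le> p1" "p0 + p1 \<le> 1"
    and P: "0 \<le> P0" "0 \<le> P1" "P0 + P1 \<le> 1"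
    and P0: "P0 = p0 + w1 / S + e0" and P1: "P1 = p1 + 2 * w2 / S + e1"
    and e: "\<bar>e0\<bar> \<le> 1 / S" "\<bar>e1\<bar> \<le> 1 / S"
begin

lemma w_bounds: "\<bar>w1\<bar> \<le> 2 * S" "\<bar>w2\<bar> \<le> S"
proof -
  have "1 / S \<le> 1" using S by simp
  then have "\<bar>w1 / S\<bar> \<le> 2" "\<bar>2 * w2 / S\<bar> \<le> 2" using P0 P1 P p e by linarith+
  then show "\<bar>w1\<bar> \<le> 2 * S" "\<bar>w2\<bar> \<le> S" using S by (auto simp: field_simps abs_divide)
qed

text \<open>The drift is negative definite and the error terms \<open>e0\<close>, \<open>e1\<close> contribute a bounded amount, because
  \<open>w1\<close> and \<open>w2\<close> are at most of order \<open>S\<close>.\<close>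
lemma second_moment_step:
  "P0 * ((w1 - 1 + p0)\<^sup>2 + (w2 + 1 - p0 + p1)\<^sup>2) + P1 * ((w1 + p0)\<^sup>2 + (w2 - 1 - p0 + p1)\<^sup>2)
     + (1 - P0 - P1) * ((w1 + p0)\<^sup>2 + (w2 - p0 + p1)\<^sup>2) \<le> w1\<^sup>2 + w2\<^sup>2 + 13"
proof -
  \<comment> \<open>The constant 13 is 5 + 2 * 4: every jump of (\<open>w1\<close>,
    \<open>w2\<close>) has squared length at most 5, and the part of the cross term due to
    \<open>e0\<close> and \<open>e1\<close> is at most 4.\<close>
  have jump: "(p0 - 1)\<^sup>2 + (1 - p0 + p1)\<^sup>2 \<le> 5" "p0\<^sup>2 + (- 1 - p0 + p1)\<^sup>2 \<le> 5" "p0\<^sup>2 + (p1 - p0)\<^sup>2 \<le> 5"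
  proof -
    have sq: "x\<^sup>2 \<le> 1" if "\<bar>x\<bar> \<le> 1" for x :: real using that by (simp add: abs_square_le_1)
    have sq4: "x\<^sup>2 \<le> 4" if "\<bar>x\<bar> \<le> 2" for x :: real using that power_mono[of "\<bar>x\<bar>" 2 2] by simp
    show "(p0 - 1)\<^sup>2 + (1 - p0 + p1)\<^sup>2 \<le> 5" "p0\<^sup>2 + (- 1 - p0 + p1)\<^sup>2 \<le> 5" "p0\<^sup>2 + (p1 - p0)\<^sup>2 \<le> 5"
      using sq[of "p0 - 1"] sq4[of "1 - p0 + p1"] sq[of p0] sq4[of "- 1 - p0 + p1"] sq4[of "p1 - p0"] p by linarith+
  qed
  have "P0 * ((w1 - 1 + p0)\<^sup>2 + (w2 + 1 - p0 + p1)\<^sup>2) + P1 * ((w1 + p0)\<^sup>2 + (w2 - 1 - p0 + p1)\<^sup>2)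
     + (1 - P0 - P1) * ((w1 + p0)\<^sup>2 + (w2 - p0 + p1)\<^sup>2)
     = w1\<^sup>2 + w2\<^sup>2 + 2 * (w1 * (p0 - P0) + w2 * ((P0 - p0) - (P1 - p1)))
       + (P0 * ((p0 - 1)\<^sup>2 + (1 - p0 + p1)\<^sup>2) + P1 * (p0\<^sup>2 + (- 1 - p0 + p1)\<^sup>2) + (1 - P0 - P1) * (p0\<^sup>2 + (p1 - p0)\<^sup>2))"
    by (simp add: power2_eq_square algebra_simps)
  \<comment> \<open>Negative definiteness as a sum of squares: -W . A W is
    \<open>w1\<^sup>2 - w1 * w2 + 2 * w2\<^sup>2\<close>, half of
    \<open>(w1 - w2)\<^sup>2 + w1\<^sup>2 + 3 * w2\<^sup>2\<close>.\<close>
  also have "w1 * (p0 - P0) + w2 * ((P0 - p0) - (P1 - p1))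
      = - (((w1 - w2)\<^sup>2 + w1\<^sup>2 + 3 * w2\<^sup>2) / (2 * S)) - w1 * e0 + w2 * (e0 - e1)"
    unfolding P0 P1 using S by (simp add: field_simps power2_eq_square)
  also have "- (((w1 - w2)\<^sup>2 + w1\<^sup>2 + 3 * w2\<^sup>2) / (2 * S)) - w1 * e0 + w2 * (e0 - e1) \<le> 4"
  proof -
    have "((w1 - w2)\<^sup>2 + w1\<^sup>2 + 3 * w2\<^sup>2) / (2 * S) \<ge> 0" using S by simp
    moreover have "\<bar>w1 * e0\<bar> \<le> (2 * S) * (1 / S)"
      unfolding abs_mult by (intro mult_mono) (use w_bounds e S in auto)
    moreover have "\<bar>w2 * (e0 - e1)\<bar> \<le> S * (2 / S)"
    proof -
      have "\<bar>e0 - e1\<bar> \<le> 1 / S + 1 / S" using e by linarith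
      then show ?thesis unfolding abs_mult by (intro mult_mono) (use w_bounds S in auto)
    qed
    moreover have "(2 * S) * (1 / S) = 2" "S * (2 / S) = 2" using S by auto
    ultimately show ?thesis by linarith
  qed
  also have "P0 * ((p0 - 1)\<^sup>2 + (1 - p0 + p1)\<^sup>2) + P1 * (p0\<^sup>2 + (- 1 - p0 + p1)\<^sup>2) + (1 - P0 - P1) * (p0\<^sup>2 + (p1 - p0)\<^sup>2)
      \<le> P0 * 5 + P1 * 5 + (1 - P0 - P1) * 5"
    using jump P by (intro add_mono mult_left_mono) auto
  finally show ?thesis by simp
qed

text \<open>The drift is kept as a factor \<open>cis\<close> instead of being expanded: multiplied
  by \<open>cis (s * w1 + t * w2)\<close> it merely shifts the frequencies, which makes a recursion
  possible. The three error terms come from the Taylor remainder, from \<open>e0\<close> and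
  \<open>e1\<close>, and from the dependence of drift and variance on \<open>w1\<close> and
  \<open>w2\<close>.\<close>

lemma char_step:
  assumes st: "\<bar>s\<bar> \<le> \<tau>" "\<bar>t\<bar> \<le> \<tau>" "\<tau> \<le> 1"
  shows "norm (P0 *\<^sub>R cis (s * (- 1 + p0) + t * (1 - p0 + p1)) + P1 *\<^sub>R cis (s * p0 + t * (- 1 - p0 + p1))
      + (1 - P0 - P1) *\<^sub>R cis (s * p0 + t * (- p0 + p1))
      - cis (((t - s) * w1 - 2 * t * w2) / S) * complex_of_real (1 - step_variance p0 p1 s t / 2))
    \<le> 23 * (\<tau> ^ 3 + \<tau> / S + \<tau>\<^sup>2 * (\<bar>w1\<bar> + \<bar>w2\<bar>) / S)"
proof -
  \<comment> \<open>\<open>\<alpha>\<close> and \<open>- t\<close> are the changes of s w1 + t w2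
    when a node of outdegree 0 or 1 is chosen, before the centre moves; \<open>\<kappa>\<close> is
    their limiting mean, which the moving centre subtracts.\<close>
  define \<alpha> \<kappa> where "\<alpha> = t - s" and "\<kappa> = p0 * \<alpha> - p1 * t"
  define y where "y = (\<alpha> * w1 - 2 * t * w2) / S"
  define b where "b = step_variance p0 p1 s t"
  define u where "u = \<bar>w1\<bar> + \<bar>w2\<bar>"
  have \<tau>: "0 \<le> \<tau>" using st by simp
  have b: "0 \<le> b" "b \<le> 4 * \<tau>\<^sup>2" unfolding b_def using step_variance_bounds[OF p st(1,2)] by auto
  have \<alpha>: "\<bar>\<alpha>\<bar> \<le> 2 * \<tau>" using st by (simp add: \<alpha>_def)
  have \<kappa>: "\<bar>\<kappa>\<bar> \<le> 2 * \<tau>"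
  proof -
    have "\<bar>\<kappa>\<bar> \<le> p0 * \<bar>\<alpha>\<bar> + p1 * \<bar>t\<bar>"
      unfolding \<kappa>_def using p by (metis abs_mult abs_of_nonneg abs_triangle_ineq4)
    also have "\<dots> \<le> p0 * (2 * \<tau>) + p1 * (2 * \<tau>)" using p st \<alpha> \<tau> by (intro add_mono mult_left_mono) auto
    also have "\<dots> \<le> 1 * (2 * \<tau>)" using p \<tau> by (simp only: distrib_right[symmetric]) (intro mult_right_mono, auto)
    finally show ?thesis by simp
  qed
  define T where "T x = 1 + \<i> * complex_of_real x - (complex_of_real x)\<^sup>2 / 2" for x :: real
  have cis3: "norm (cis x - T x) \<le> 11 * \<tau> ^ 3" if "\<bar>x\<bar> \<le> 4 * \<tau>" for x
  proof -
    have "norm (cis x - T x) \<le> \<bar>x\<bar> ^ 3 / 6" using norm_cis_approx(3)[of x] by (simp add: T_def)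
    also have "\<dots> \<le> (4 * \<tau>) ^ 3 / 6" using that by (intro divide_right_mono power_mono) auto
    also have "\<dots> \<le> 11 * \<tau> ^ 3" using \<tau> by (simp add: power_mult_distrib)
    finally show ?thesis .
  qed
  define d1 where "d1 = e0 * \<alpha> - e1 * t"
  define d2 where "d2 = (P0 - p0) * (\<alpha>\<^sup>2 - 2 * \<alpha> * \<kappa>) + (P1 - p1) * (t\<^sup>2 + 2 * t * \<kappa>)"
  have PT: "P0 * T (\<alpha> - \<kappa>) + P1 * T (- t - \<kappa>) + (1 - P0 - P1) * T (- \<kappa>)
     = 1 + \<i> * y - b / 2 + (\<i> * d1 - d2 / 2)"
  proof -
    have r1: "P0 * (\<alpha> - \<kappa>) + P1 * (- t - \<kappa>) + (1 - P0 - P1) * (- \<kappa>) = y + d1"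
      unfolding \<kappa>_def y_def d1_def P0 P1 using S by (simp add: field_simps)
    have r2: "P0 * (\<alpha> - \<kappa>)\<^sup>2 + P1 * (- t - \<kappa>)\<^sup>2 + (1 - P0 - P1) * (- \<kappa>)\<^sup>2 = b + d2"
      unfolding \<kappa>_def b_def d2_def step_variance_def \<alpha>_def[symmetric] by (simp add: power2_eq_square algebra_simps)
    have "P0 * T (\<alpha> - \<kappa>) + P1 * T (- t - \<kappa>) + (1 - P0 - P1) * T (- \<kappa>)
      = 1 + \<i> * complex_of_real (P0 * (\<alpha> - \<kappa>) + P1 * (- t - \<kappa>) + (1 - P0 - P1) * (- \<kappa>))
        - complex_of_real (P0 * (\<alpha> - \<kappa>)\<^sup>2 + P1 * (- t - \<kappa>)\<^sup>2 + (1 - P0 - P1) * (- \<kappa>)\<^sup>2) / 2"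
      unfolding T_def by (simp add: field_simps power2_eq_square)
    then show ?thesis unfolding r1 r2 by (simp add: add_divide_distrib algebra_simps)
  qed
  have u: "0 \<le> u" by (simp add: u_def)
  have d1: "\<bar>d1\<bar> \<le> 3 * (\<tau> / S)"
  proof -
    have "\<bar>d1\<bar> \<le> \<bar>e0\<bar> * \<bar>\<alpha>\<bar> + \<bar>e1\<bar> * \<bar>t\<bar>"
      unfolding d1_def by (metis abs_mult abs_triangle_ineq4)
    also have "\<dots> \<le> (1 / S) * (2 * \<tau>) + (1 / S) * \<tau>"
      using e \<alpha> st S \<tau> by (intro add_mono mult_mono) auto
    finally show ?thesis by simp
  qed
  have d2: "\<bar>d2\<bar> \<le> 12 * (\<tau>\<^sup>2 * u / S) + 17 * (\<tau> / S)"
  proof -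
    have a: "\<bar>\<alpha>\<^sup>2 - 2 * \<alpha> * \<kappa>\<bar> \<le> 12 * \<tau>\<^sup>2"
    proof -
      have "\<bar>\<alpha>\<^sup>2 - 2 * \<alpha> * \<kappa>\<bar> = \<bar>\<alpha>\<bar> * \<bar>\<alpha> - 2 * \<kappa>\<bar>" by (simp add: abs_mult[symmetric] power2_eq_square algebra_simps)
      also have "\<dots> \<le> (2 * \<tau>) * (6 * \<tau>)" using \<alpha> \<kappa> \<tau> by (intro mult_mono) auto
      finally show ?thesis by (simp add: power2_eq_square)
    qed
    have c: "\<bar>t\<^sup>2 + 2 * t * \<kappa>\<bar> \<le> 5 * \<tau>\<^sup>2"
    proof -
      have "\<bar>t\<^sup>2 + 2 * t * \<kappa>\<bar> = \<bar>t\<bar> * \<bar>t + 2 * \<kappa>\<bar>" by (simp add: abs_mult[symmetric] power2_eq_square algebra_simps)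
      also have "\<dots> \<le> \<tau> * (5 * \<tau>)" using st \<kappa> \<tau> by (intro mult_mono) auto
      finally show ?thesis by (simp add: power2_eq_square)
    qed
    have P0': "\<bar>P0 - p0\<bar> \<le> \<bar>w1\<bar> / S + 1 / S"
    proof -
      have "\<bar>P0 - p0\<bar> \<le> \<bar>w1 / S\<bar> + \<bar>e0\<bar>" using P0 by linarith
      then show ?thesis using e S by simp
    qed
    have P1': "\<bar>P1 - p1\<bar> \<le> 2 * \<bar>w2\<bar> / S + 1 / S"
    proof -
      have "\<bar>P1 - p1\<bar> \<le> \<bar>2 * w2 / S\<bar> + \<bar>e1\<bar>" using P1 by linarith
      then show ?thesis using e S by (simp add: abs_mult)
    qed
    have "\<bar>d2\<bar> \<le> \<bar>P0 - p0\<bar> * \<bar>\<alpha>\<^sup>2 - 2 * \<alpha> * \<kappa>\<bar> + \<bar>P1 - p1\<bar> * \<bar>t\<^sup>2 + 2 * t * \<kappa>\<bar>"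
      unfolding d2_def by (metis abs_mult abs_triangle_ineq)
    also have "\<dots> \<le> (\<bar>w1\<bar> / S + 1 / S) * (12 * \<tau>\<^sup>2) + (2 * \<bar>w2\<bar> / S + 1 / S) * (5 * \<tau>\<^sup>2)"
      by (intro add_mono mult_mono P0' P1' a c) (use S in auto)
    also have "\<dots> = (12 * \<bar>w1\<bar> + 10 * \<bar>w2\<bar>) * (\<tau>\<^sup>2 / S) + 17 * (\<tau>\<^sup>2 / S)"
      using S by (simp add: field_simps)
    also have "\<dots> \<le> (12 * u) * (\<tau>\<^sup>2 / S) + 17 * (\<tau> / S)"
      using S st \<tau> by (intro add_mono mult_mono divide_right_mono) (auto simp: u_def power2_eq_square mult_left_le)
    finally show ?thesis by (simp add: mult_ac)
  qed
  have y: "\<bar>y\<bar> \<le> 2 * (\<tau> * u / S)"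
  proof -
    have "\<bar>\<alpha> * w1 - 2 * t * w2\<bar> \<le> \<bar>\<alpha>\<bar> * \<bar>w1\<bar> + 2 * \<bar>t\<bar> * \<bar>w2\<bar>"
      using abs_triangle_ineq4[of "\<alpha> * w1" "2 * t * w2"] by (simp add: abs_mult)
    also have "\<dots> \<le> (2 * \<tau>) * \<bar>w1\<bar> + 2 * \<tau> * \<bar>w2\<bar>"
      using \<alpha> st by (intro add_mono mult_mono) auto
    finally show ?thesis using S unfolding y_def u_def by (simp add: field_simps)
  qed
  have y6: "\<bar>y\<bar> \<le> 6 * \<tau>"
  proof -
    have "\<tau> * u / S \<le> \<tau> * (3 * S) / S"
      using w_bounds S \<tau> by (intro divide_right_mono mult_left_mono) (auto simp: u_def)
    with y S show ?thesis by simp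
  qed
  \<comment> \<open>Bounding one factor by \<open>6 * \<tau>\<close> and only the other through
    \<open>u\<close> keeps the estimate linear in \<open>u\<close>, so that a first absolute moment
    suffices later.\<close>
  have ysq: "y\<^sup>2 / 2 \<le> 6 * (\<tau>\<^sup>2 * u / S)"
  proof -
    have "y\<^sup>2 = \<bar>y\<bar> * \<bar>y\<bar>" by (simp add: power2_eq_square)
    also have "\<dots> \<le> (6 * \<tau>) * (2 * (\<tau> * u / S))" using y y6 \<tau> by (intro mult_mono) auto
    finally show ?thesis by (simp add: power2_eq_square mult_ac)
  qed
  have yb: "\<bar>y\<bar> * (b / 2) \<le> 12 * \<tau> ^ 3"
  proof -
    have "\<bar>y\<bar> * (b / 2) \<le> (6 * \<tau>) * (2 * \<tau>\<^sup>2)" using y6 b \<tau> by (intro mult_mono) auto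
    then show ?thesis by (simp add: power2_eq_square power3_eq_cube)
  qed
  have arg: "s * (- 1 + p0) + t * (1 - p0 + p1) = \<alpha> - \<kappa>" "s * p0 + t * (- 1 - p0 + p1) = - t - \<kappa>"
    "s * p0 + t * (- p0 + p1) = - \<kappa>" "((t - s) * w1 - 2 * t * w2) / S = y"
    by (simp_all add: \<alpha>_def \<kappa>_def y_def algebra_simps)
  define A where "A = P0 *\<^sub>R (cis (\<alpha> - \<kappa>) - T (\<alpha> - \<kappa>)) + P1 *\<^sub>R (cis (- t - \<kappa>) - T (- t - \<kappa>))
      + (1 - P0 - P1) *\<^sub>R (cis (- \<kappa>) - T (- \<kappa>))"
  have A: "norm A \<le> 11 * \<tau> ^ 3"
  proof -
    have "norm A \<le> P0 * norm (cis (\<alpha> - \<kappa>) - T (\<alpha> - \<kappa>)) + P1 * norm (cis (- t - \<kappa>) - T (- t - \<kappa>))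
        + (1 - P0 - P1) * norm (cis (- \<kappa>) - T (- \<kappa>))"
      unfolding A_def using P by (intro norm_triangle_le add_mono) auto
    also have "\<dots> \<le> P0 * (11 * \<tau> ^ 3) + P1 * (11 * \<tau> ^ 3) + (1 - P0 - P1) * (11 * \<tau> ^ 3)"
      using P \<alpha> \<kappa> st \<tau> by (intro add_mono mult_left_mono cis3) auto
    finally show ?thesis by (simp add: algebra_simps)
  qed
  have "P0 *\<^sub>R cis (\<alpha> - \<kappa>) + P1 *\<^sub>R cis (- t - \<kappa>) + (1 - P0 - P1) *\<^sub>R cis (- \<kappa>) - cis y * complex_of_real (1 - b / 2)
    = A + (P0 * T (\<alpha> - \<kappa>) + P1 * T (- t - \<kappa>) + (1 - P0 - P1) * T (- \<kappa>)) - cis y * complex_of_real (1 - b / 2)"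
    unfolding A_def by (simp add: scaleR_conv_of_real algebra_simps)
  also have "\<dots> = A + (\<i> * d1 - d2 / 2) - (cis y - (1 + \<i> * y)) + (cis y - 1) * complex_of_real (b / 2)"
    unfolding PT by (simp add: field_simps)
  also have "norm \<dots> \<le> norm A + (\<bar>d1\<bar> + \<bar>d2\<bar> / 2) + norm (cis y - (1 + \<i> * y)) + norm (cis y - 1) * (b / 2)"
  proof -
    have "norm (A + B - C + D) \<le> norm A + norm B + norm C + norm D" for A B C D :: complex
      using norm_triangle_ineq[of "A + B - C" D] norm_triangle_ineq4[of "A + B" C] norm_triangle_ineq[of A B]
      by linarith
    moreover have "norm (\<i> * d1 - d2 / 2) \<le> \<bar>d1\<bar> + \<bar>d2\<bar> / 2"
      using norm_triangle_ineq4[of "\<i> * d1" "d2 / 2"] by (simp add: norm_mult)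
    moreover have "norm ((cis y - 1) * complex_of_real (b / 2)) = norm (cis y - 1) * (b / 2)"
      using b by (simp add: norm_mult)
    ultimately show ?thesis by (smt (verit))
  qed
  also have "\<dots> \<le> 11 * \<tau> ^ 3 + (3 * (\<tau> / S) + (12 * (\<tau>\<^sup>2 * u / S) + 17 * (\<tau> / S)) / 2) + y\<^sup>2 / 2 + \<bar>y\<bar> * (b / 2)"
    using A d1 d2 norm_cis_approx(1,2)[of y] b by (intro add_mono mult_right_mono) auto
  \<comment> \<open>The coefficients are 11 + 12 for \<open>\<tau> ^ 3\<close>, 3 + 17 / 2 for
    \<open>\<tau> / S\<close> and 6 + 6 for the last term; 23 is the largest.\<close>
  also have "\<dots> \<le> 23 * (\<tau> ^ 3 + \<tau> / S + \<tau>\<^sup>2 * u / S)"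
  proof -
    have "\<tau> / S \<ge> 0" "\<tau>\<^sup>2 * u / S \<ge> 0" using \<tau> S u by auto
    with ysq yb show ?thesis by argo
  qed
  finally show ?thesis unfolding arg b_def u_def .
qed

end

text \<open>The hypothesis \<open>lyapunov\<close> is the Lyapunov equation for the limiting covariance, written as an
  identity of quadratic forms.\<close>
lemma gauss_step:
  fixes a b c m N S s t \<tau> p0 p1 :: real
  defines "q \<equiv> \<lambda>s t. a * s\<^sup>2 + 2 * b * s * t + c * t\<^sup>2"
  assumes p: "0 \<le> p0" "0 \<le> p1" "p0 + p1 \<le> 1"
    and q: "\<And>s t. q s t \<ge> 0"
    and lyapunov: "q s t / m - 2 / (m + 1) * (a * s * (t - s) + b * (s * (- 2 * t) + t * (t - s)) + c * t * (- 2 * t))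
        = step_variance p0 p1 s t"
    and m: "m \<ge> 1" and N: "0 \<le> N" "N \<le> S" and S: "S \<ge> 1" "\<bar>N * (m + 1) / m - S\<bar> \<le> 1"
    and st: "\<bar>s\<bar> \<le> \<tau>" "\<bar>t\<bar> \<le> \<tau>" "\<tau> \<le> 1"
  shows "\<bar>exp (- ((N + 1) / m * q s t / 2))
      - exp (- (N / m * q (s + (t - s) / S) (t - 2 * t / S) / 2)) * (1 - step_variance p0 p1 s t / 2)\<bar>
    \<le> (4 * (\<bar>a\<bar> + 2 * \<bar>b\<bar> + \<bar>c\<bar>) + 4) * (\<tau> ^ 3 + \<tau> / S)"
proof -
  define Q where "Q = \<bar>a\<bar> + 2 * \<bar>b\<bar> + \<bar>c\<bar>"
  define \<beta> where "\<beta> = step_variance p0 p1 s t / 2"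
  define u where "u = (N + 1) / m * q s t / 2"
  define v where "v = N / m * q (s + (t - s) / S) (t - 2 * t / S) / 2"
  \<comment> \<open>The bilinear form of \<open>q\<close> at theta = (\<open>s\<close>,
    \<open>t\<close>) and at the drift direction A^T theta = (\<open>t - s\<close>,
    \<open>- 2 * t\<close>).\<close>
  define l where "l = a * s * (t - s) + b * (s * (- 2 * t) + t * (t - s)) + c * t * (- 2 * t)"
  have \<tau>: "0 \<le> \<tau>" using st by simp
  have \<beta>: "0 \<le> \<beta>" "\<beta> \<le> 2 * \<tau>\<^sup>2" unfolding \<beta>_def using step_variance_bounds[OF p st(1,2)] by auto
  have uv: "0 \<le> u" "0 \<le> v" unfolding u_def v_def using q N m by auto
  have exp1: "\<bar>exp (- x) - exp (- y)\<bar> \<le> \<bar>x - y\<bar>" if "0 \<le> x" "0 \<le> y" for x y :: real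
  proof -
    have *: "exp (- x) - exp (- y) \<le> y - x" if "0 \<le> x" "x \<le> y" for x y :: real
    proof -
      have "exp (- x) - exp (- y) = exp (- x) * (1 - exp (- (y - x)))" by (simp add: algebra_simps exp_add[symmetric])
      also have "\<dots> \<le> 1 * (y - x)"
      proof (intro mult_mono)
        show "1 - exp (- (y - x)) \<le> y - x" using exp_ge_add_one_self[of "- (y - x)"] by linarith
      qed (use that in auto)
      finally show ?thesis by simp
    qed
    show ?thesis using *[of x y] *[of y x] that by (cases "x \<le> y") auto
  qed
  have exp2: "\<bar>exp (- \<beta>) - (1 - \<beta>)\<bar> \<le> \<beta>\<^sup>2"
  proof -
    have "exp (- \<beta>) * (1 + \<beta>) \<le> exp (- \<beta>) * exp \<beta>" using exp_ge_add_one_self[of \<beta>] by (intro mult_left_mono) auto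
    then have "exp (- \<beta>) \<le> 1 / (1 + \<beta>)" using \<beta>(1) by (simp add: exp_add[symmetric] field_simps)
    also have "\<dots> \<le> 1 - \<beta> + \<beta>\<^sup>2"
      using \<beta>(1) by (simp add: field_simps power2_eq_square)
    finally show ?thesis using exp_ge_add_one_self[of "- \<beta>"] zero_le_power2[of \<beta>] by linarith
  qed
  have l: "\<bar>l\<bar> \<le> 2 * Q * \<tau>\<^sup>2"
  proof -
    have 1: "\<bar>x * y\<bar> \<le> 2 * \<tau>\<^sup>2" if "\<bar>x\<bar> \<le> \<tau>" "\<bar>y\<bar> \<le> 2 * \<tau>" for x y
      using mult_mono[OF that] \<tau> by (simp add: abs_mult power2_eq_square)
    have "\<bar>l\<bar> \<le> \<bar>a\<bar> * \<bar>s * (t - s)\<bar> + \<bar>b\<bar> * (\<bar>s * (- 2 * t)\<bar> + \<bar>t * (t - s)\<bar>) + \<bar>c\<bar> * \<bar>t * (- 2 * t)\<bar>"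
    proof -
      have "\<bar>x + y + z\<bar> \<le> \<bar>x\<bar> + \<bar>y\<bar> + \<bar>z\<bar>" for x y z :: real by simp
      from this[of "a * (s * (t - s))" "b * (s * (- 2 * t) + t * (t - s))" "c * (t * (- 2 * t))"]
      have "\<bar>l\<bar> \<le> \<bar>a\<bar> * \<bar>s * (t - s)\<bar> + \<bar>b\<bar> * \<bar>s * (- 2 * t) + t * (t - s)\<bar> + \<bar>c\<bar> * \<bar>t * (- 2 * t)\<bar>"
        unfolding l_def abs_mult[symmetric] by (simp only: mult.assoc)
      also have "\<bar>b\<bar> * \<bar>s * (- 2 * t) + t * (t - s)\<bar> \<le> \<bar>b\<bar> * (\<bar>s * (- 2 * t)\<bar> + \<bar>t * (t - s)\<bar>)"
        by (intro mult_left_mono abs_triangle_ineq) auto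
      finally show ?thesis by simp
    qed
    also have "\<dots> \<le> \<bar>a\<bar> * (2 * \<tau>\<^sup>2) + \<bar>b\<bar> * (2 * \<tau>\<^sup>2 + 2 * \<tau>\<^sup>2) + \<bar>c\<bar> * (2 * \<tau>\<^sup>2)"
      using st by (intro add_mono mult_left_mono 1) auto
    finally show ?thesis by (simp add: Q_def algebra_simps)
  qed
  have qa: "\<bar>q (t - s) (- 2 * t)\<bar> \<le> 4 * Q * \<tau>\<^sup>2"
  proof -
    have ts: "\<bar>t - s\<bar> \<le> 2 * \<tau>" "\<bar>- 2 * t\<bar> \<le> 2 * \<tau>" using st by linarith+
    have 1: "\<bar>x * y\<bar> \<le> 4 * \<tau>\<^sup>2" if "\<bar>x\<bar> \<le> 2 * \<tau>" "\<bar>y\<bar> \<le> 2 * \<tau>" for x y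
      using mult_mono[OF that] \<tau> by (simp add: abs_mult power2_eq_square)
    have "\<bar>x + y + z\<bar> \<le> \<bar>x\<bar> + \<bar>y\<bar> + \<bar>z\<bar>" for x y z :: real by simp
    from this[of "a * ((t - s) * (t - s))" "2 * b * ((t - s) * (- 2 * t))" "c * ((- 2 * t) * (- 2 * t))"]
    have "\<bar>q (t - s) (- 2 * t)\<bar> \<le> \<bar>a\<bar> * \<bar>(t - s) * (t - s)\<bar> + (2 * \<bar>b\<bar>) * \<bar>(t - s) * (- 2 * t)\<bar> + \<bar>c\<bar> * \<bar>(- 2 * t) * (- 2 * t)\<bar>"
      unfolding q_def abs_mult power2_eq_square by (simp add: mult_ac)
    also have "\<dots> \<le> \<bar>a\<bar> * (4 * \<tau>\<^sup>2) + (2 * \<bar>b\<bar>) * (4 * \<tau>\<^sup>2) + \<bar>c\<bar> * (4 * \<tau>\<^sup>2)"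
      by (intro add_mono mult_left_mono 1 ts) auto
    finally show ?thesis by (simp add: Q_def algebra_simps)
  qed
  have q': "q (s + (t - s) / S) (t - 2 * t / S) = q s t + 2 / S * l + q (t - s) (- 2 * t) / S\<^sup>2"
    unfolding q_def l_def using S by (simp add: field_simps power2_eq_square)
  \<comment> \<open>With \<open>N / m / S\<close> replaced by its limit \<open>1 / (m + 1)\<close>
    the terms up to first order in the shift cancel exactly by \<open>lyapunov\<close>. What is left
    is the error of this replacement, at most \<open>1 / S\<close> times
    \<open>\<bar>l\<bar>\<close>, and the term quadratic in the shift.\<close>
  have "u - (v + \<beta>) = (q s t / m - 2 * (N / m / S) * l - (N / m / S\<^sup>2) * q (t - s) (- 2 * t) - step_variance p0 p1 s t) / 2"
    unfolding u_def v_def \<beta>_def q' using m S by (simp add: field_simps)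
  also have "\<dots> = - (N / m / S - 1 / (m + 1)) * l - (N / m / S\<^sup>2) * q (t - s) (- 2 * t) / 2"
  proof -
    have "(x - 2 * k * l - k' * w - (x - 2 * r * l)) / 2 = - (k - r) * l - k' * w / 2" for x k k' w r
      by (simp add: algebra_simps diff_divide_distrib add_divide_distrib)
    moreover have r: "2 / (m + 1) = 2 * (1 / (m + 1))" by simp
    ultimately show ?thesis
      unfolding lyapunov[symmetric] l_def[symmetric] r by blast
  qed
  also have "\<bar>\<dots>\<bar> \<le> \<bar>N / m / S - 1 / (m + 1)\<bar> * \<bar>l\<bar> + (N / m / S\<^sup>2) * \<bar>q (t - s) (- 2 * t)\<bar> / 2"
  proof -
    have "\<bar>- x * y - z * w / 2\<bar> \<le> \<bar>x\<bar> * \<bar>y\<bar> + z * \<bar>w\<bar> / 2" if "z \<ge> 0" for x y z w :: real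
    proof -
      have "\<bar>- x * y - z * w / 2\<bar> \<le> \<bar>- x * y\<bar> + \<bar>z * w / 2\<bar>" by (rule abs_triangle_ineq4)
      with that show ?thesis by (simp add: abs_mult)
    qed
    moreover have "N / m / S\<^sup>2 \<ge> 0" using N m S by simp
    ultimately show ?thesis by blast
  qed
  also have "\<dots> \<le> (1 / S) * (2 * Q * \<tau>\<^sup>2) + (1 / S) * (4 * Q * \<tau>\<^sup>2) / 2"
  proof -
    have "N / m / S - 1 / (m + 1) = (N * (m + 1) / m - S) / (S * (m + 1))"
      using m S by (simp add: field_simps)
    then have "\<bar>N / m / S - 1 / (m + 1)\<bar> = \<bar>N * (m + 1) / m - S\<bar> / (S * (m + 1))"
      using m S by (simp add: abs_divide)
    also have "\<dots> \<le> 1 / S" using S m by (intro frac_le) auto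
    finally have 1: "\<bar>N / m / S - 1 / (m + 1)\<bar> \<le> 1 / S" .
    have "N / m \<le> S / 1" using N m by (intro frac_le) auto
    then have "N / m / S\<^sup>2 \<le> S / S\<^sup>2" using S by (intro divide_right_mono) auto
    then have 2: "N / m / S\<^sup>2 \<le> 1 / S" using S by (simp add: power2_eq_square)
    show ?thesis using 1 2 l qa N m S by (intro add_mono mult_mono divide_right_mono) auto
  qed
  also have "\<dots> = 4 * Q * (\<tau>\<^sup>2 / S)" by simp
  finally have uvb: "\<bar>u - (v + \<beta>)\<bar> \<le> 4 * Q * (\<tau>\<^sup>2 / S)" .
  have "exp (- u) - exp (- v) * (1 - \<beta>) = (exp (- u) - exp (- (v + \<beta>))) + exp (- v) * (exp (- \<beta>) - (1 - \<beta>))"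
    by (simp add: algebra_simps exp_add[symmetric])
  also have "\<bar>\<dots>\<bar> \<le> \<bar>exp (- u) - exp (- (v + \<beta>))\<bar> + exp (- v) * \<bar>exp (- \<beta>) - (1 - \<beta>)\<bar>"
    by (rule order.trans[OF abs_triangle_ineq]) (simp add: abs_mult)
  also have "\<dots> \<le> 4 * Q * (\<tau>\<^sup>2 / S) + 1 * \<beta>\<^sup>2"
    using exp1[of u "v + \<beta>"] uv \<beta> uvb exp2 by (intro add_mono mult_mono) auto
  also have "\<dots> \<le> 4 * Q * (\<tau> / S) + 4 * \<tau> ^ 3"
  proof -
    have "\<beta>\<^sup>2 \<le> (2 * \<tau>\<^sup>2)\<^sup>2" using \<beta> by (intro power_mono) auto
    also have "\<dots> = 4 * (\<tau> ^ 3 * \<tau>)" by (simp add: power2_eq_square power3_eq_cube)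
    also have "\<dots> \<le> 4 * \<tau> ^ 3" using st \<tau> by (simp add: mult_left_le)
    finally have "\<beta>\<^sup>2 \<le> 4 * \<tau> ^ 3" .
    moreover have "\<tau>\<^sup>2 / S \<le> \<tau> / S" using st \<tau> S by (intro divide_right_mono) (auto simp: power2_eq_square mult_left_le)
    moreover have "Q \<ge> 0" by (simp add: Q_def)
    ultimately show ?thesis by (intro add_mono mult_left_mono) auto
  qed
  also have "\<dots> \<le> (4 * Q + 4) * (\<tau> ^ 3 + \<tau> / S)"
    using \<tau> S by (simp add: Q_def algebra_simps)
  finally show ?thesis unfolding u_def v_def \<beta>_def Q_def .
qed

section \<open>The circuit as a Markov chain of parent choices\<close>

lemma
  assumes "n > 0"
  shows pmf_pick_parent: "pmf (pick_parent n d) v = (if v < n then real (d v + 1) / (\<Sum>u<n. real (d u + 1)) else 0)"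
    and set_pick_parent: "set_pmf (pick_parent n d) = {..<n}"
proof -
  define S where "S = (\<Sum>u<n. real (d u + 1))"
  have "S > 0" unfolding S_def using assms by (intro sum_pos) auto
  have 1: "(if v < n then real (d v + 1) / S else 0) \<ge> 0" for v
    using \<open>S > 0\<close> by simp
  have "(\<integral>\<^sup>+v. ennreal (if v < n then real (d v + 1) / S else 0) \<partial>count_space UNIV)
      = (\<Sum>v<n. ennreal (real (d v + 1) / S))"
    by (subst nn_integral_count_space'[of "{..<n}"]) auto
  also have "\<dots> = ennreal (\<Sum>v<n. real (d v + 1) / S)"
    using \<open>S > 0\<close> by (intro sum_ennreal) auto
  also have "(\<Sum>v<n. real (d v + 1) / S) = 1"
    using \<open>S > 0\<close> unfolding sum_divide_distrib[symmetric] S_def[symmetric] by simp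
  finally have 2: "(\<integral>\<^sup>+v. ennreal (if v < n then real (d v + 1) / S else 0) \<partial>count_space UNIV) = 1" by simp
  show "pmf (pick_parent n d) v = (if v < n then real (d v + 1) / (\<Sum>u<n. real (d u + 1)) else 0)" for v
    unfolding pick_parent_def S_def[symmetric] by (rule pmf_embed_pmf[OF 1 2])
  show "set_pmf (pick_parent n d) = {..<n}"
    unfolding pick_parent_def S_def[symmetric] using \<open>S > 0\<close> by (subst set_embed_pmf[OF 1 2]) auto
qed

lemma expectation_pick_parent:
  fixes F :: "nat \<Rightarrow> 'b :: {banach, second_countable_topology}"
  assumes "n > 0"
  shows "measure_pmf.expectation (pick_parent n d) F = (\<Sum>v<n. (real (d v + 1) / (\<Sum>u<n. real (d u + 1))) *\<^sub>R F v)"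
  using assms by (subst integral_measure_pmf[of "{..<n}"]) (auto simp: set_pick_parent pmf_pick_parent)

definition attach :: "nat \<Rightarrow> (nat \<Rightarrow> nat) \<Rightarrow> (nat \<Rightarrow> nat) pmf" where
  "attach n d = map_pmf (\<lambda>v. d(v := Suc (d v))) (pick_parent n d)"

text \<open>The definition splits off the first choice of a round, whereas \<open>chain\<close>
  appends choices at the end; splitting off the last one makes the two comparable.\<close>

lemma choose_parents_Suc_right:
  "choose_parents n (Suc k) d = bind_pmf (choose_parents n k d) (attach n)"
proof (induction k arbitrary: d)
  case 0
  then show ?case by (simp add: attach_def map_pmf_def bind_return_pmf)
next
  case (Suc k)
  have "choose_parents n (Suc (Suc k)) d = bind_pmf (pick_parent n d) (\<lambda>v. choose_parents n (Suc k) (d(v := Suc (d v))))"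
    by (rule choose_parents.simps)
  also have "\<dots> = bind_pmf (pick_parent n d) (\<lambda>v. bind_pmf (choose_parents n k (d(v := Suc (d v)))) (attach n))"
    by (simp only: Suc.IH)
  also have "\<dots> = bind_pmf (choose_parents n (Suc k) d) (attach n)"
    by (simp add: bind_assoc_pmf)
  finally show ?case .
qed

text \<open>The circuit observed after each single parent choice: \<open>N div m\<close> nodes have been completed
  besides node \<open>0\<close>, and node \<open>Suc (N div m)\<close> has already chosen \<open>N mod m\<close> parents.\<close>
primrec chain :: "nat \<Rightarrow> nat \<Rightarrow> (nat \<Rightarrow> nat) pmf" where
  "chain m 0 = return_pmf (\<lambda>_. 0)"
| "chain m (Suc N) = bind_pmf (chain m N) (attach (Suc (N div m)))"

lemma outdeg_count_conv_sum: "real (outdeg_count k n d) = (\<Sum>u\<le>n. of_bool (d u = k))"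
proof -
  have "{v. v \<le> n \<and> d v = k} = {..n} \<inter> {v. d v = k}" by auto
  then show ?thesis unfolding outdeg_count_def by (simp add: of_bool_def sum.If_cases)
qed

lemma outdeg_count_Suc: "real (outdeg_count k (Suc n) d) = real (outdeg_count k n d) + of_bool (d (Suc n) = k)"
  by (simp add: outdeg_count_conv_sum)

lemma outdeg_count_upd:
  assumes "v \<le> n"
  shows "real (outdeg_count k n (d(v := Suc (d v)))) = real (outdeg_count k n d) + of_bool (Suc (d v) = k) - of_bool (d v = k)"
proof -
  have "(\<Sum>u\<le>n. of_bool ((d(v := Suc (d v))) u = k) :: real)
    = (\<Sum>u\<le>n. of_bool (d u = k) + (if u = v then of_bool (Suc (d v) = k) - of_bool (d v = k) else 0))"
    by (intro sum.cong) auto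
  also have "\<dots> = (\<Sum>u\<le>n. of_bool (d u = k)) + (of_bool (Suc (d v) = k) - of_bool (d v = k))"
    using assms by (subst sum.distrib) (simp add: sum.delta)
  finally show ?thesis by (simp add: outdeg_count_conv_sum)
qed

locale circuit =
  fixes m :: nat
  assumes m: "m \<ge> 1"
begin

lemma pa_circuit_conv_chain: "pa_circuit m n = chain m (n * m)"
proof (induction n)
  case (Suc n)
  have "bind_pmf (pa_circuit m n) (choose_parents (Suc n) k) = chain m (n * m + k)" if "k \<le> m" for k
    using that
  proof (induction k)
    case 0
    then show ?case using Suc.IH by (simp add: bind_return_pmf')
  next
    case (Suc k)
    have "bind_pmf (pa_circuit m n) (choose_parents (Suc n) (Suc k))
      = bind_pmf (bind_pmf (pa_circuit m n) (choose_parents (Suc n) k)) (attach (Suc n))"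
      unfolding choose_parents_Suc_right[abs_def] by (simp add: bind_assoc_pmf)
    also have "\<dots> = chain m (n * m + Suc k)"
      using Suc by simp
    finally show ?case .
  qed
  from this[of m] show ?case by (simp add: add.commute)
qed simp

text \<open>Whatever parents are chosen, the outdegrees add up to the number of choices, which makes
  the total weight a deterministic function of \<open>N\<close>. The first conjunct ensures that a
  new node enters the counts with outdegree 0.\<close>

lemma chain_invariant:
  assumes "d \<in> set_pmf (chain m N)"
  shows "(\<forall>v > N div m. d v = 0) \<and> (\<Sum>u\<le>N div m. d u) = N"
  using assms
proof (induction N arbitrary: d)
  case (Suc N)
  define n where "n = N div m"
  from Suc.prems have "\<exists>d0\<in>set_pmf (chain m N). \<exists>v<Suc n. d = d0(v := Suc (d0 v))"
    by (auto simp: attach_def set_pick_parent n_def)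
  then obtain d0 v where d0: "d0 \<in> set_pmf (chain m N)" and v: "v \<le> n" and d: "d = d0(v := Suc (d0 v))"
    by (auto simp: less_Suc_eq_le)
  have inv: "\<forall>v > n. d0 v = 0" "(\<Sum>u\<le>n. d0 u) = N" using Suc.IH[OF d0] by (auto simp: n_def)
  have n': "Suc N div m = n \<or> Suc N div m = Suc n"
    unfolding n_def by (simp add: div_Suc)
  have "(\<Sum>u\<le>n. d u) = (\<Sum>u\<le>n. d0 u + (if u = v then 1 else 0))" unfolding d by (intro sum.cong) auto
  also have "\<dots> = Suc N" using v inv by (simp add: sum.distrib sum.delta)
  finally have s: "(\<Sum>u\<le>n. d u) = Suc N" .
  have z: "\<forall>v > n. d v = 0" using inv v unfolding d by auto
  show ?case using n' s z by auto
qed simp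

lemma finite_set_chain [simp]: "finite (set_pmf (chain m N))"
  by (induction N) (auto simp: attach_def set_pick_parent)

lemma integrable_chain [simp]:
  fixes f :: "_ \<Rightarrow> 'b :: {banach, second_countable_topology}"
  shows "integrable (measure_pmf (chain m N)) f"
  by (rule integrable_measure_pmf_finite) simp

lemma expectation_chain_Suc:
  fixes F :: "(nat \<Rightarrow> nat) \<Rightarrow> 'b :: {banach, second_countable_topology}"
  shows "measure_pmf.expectation (chain m (Suc N)) F
    = measure_pmf.expectation (chain m N)
        (\<lambda>d. measure_pmf.expectation (pick_parent (Suc (N div m)) d) (\<lambda>v. F (d(v := Suc (d v)))))"
proof -
  have "measure_pmf.expectation (chain m (Suc N)) F
    = (\<Sum>d\<in>set_pmf (chain m N). pmf (chain m N) d *\<^sub>R measure_pmf.expectation (attach (Suc (N div m)) d) F)"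
    by (simp, subst pmf_expectation_bind[of "set_pmf (chain m N)"]) (auto simp: attach_def set_pick_parent)
  also have "\<dots> = measure_pmf.expectation (chain m N) (\<lambda>d. measure_pmf.expectation (attach (Suc (N div m)) d) F)"
    by (subst integral_measure_pmf[of "set_pmf (chain m N)"]) auto
  finally show ?thesis by (simp add: attach_def)
qed

text \<open>The solutions of the balance per choice, where the weight grows by (m + 1) / m on
  average: 1 / m - p0 = p0 (m + 1) / m for outdegree 0, and p0 - p1 = (p1 / 2) (m + 1) / m for
  outdegree 1, whose nodes have weight 2.\<close>

definition "p0 = 1 / (2 * real m + 1)"
definition "p1 = 2 * real m / ((3 * real m + 1) * (2 * real m + 1))"

text \<open>The term \<open>(N mod m) / m\<close> accounts for the part of the new node already attached,
  so that every single choice has the same asymptotic drift.\<close>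
definition "w1 N d = real (outdeg_count 0 (N div m) d) + real (N mod m) / m - (real m + 1) / (2 * real m + 1) * (real N / m)"
definition "w2 N d = real (outdeg_count 1 (N div m) d) - real m * (real m + 1) / ((3 * real m + 1) * (2 * real m + 1)) * (real N / m)"

definition "weight N = real N + real (N div m) + 1"

definition "P0 N d = real (outdeg_count 0 (N div m) d) / weight N"
definition "P1 N d = 2 * real (outdeg_count 1 (N div m) d) / weight N"

lemma p_bounds: "0 \<le> p0" "0 \<le> p1" "p0 + p1 \<le> 1"
proof -
  have "p0 + p1 = (5 * real m + 1) / ((3 * real m + 1) * (2 * real m + 1))"
    unfolding p0_def p1_def by (simp add: divide_simps)
  also have "\<dots> \<le> 1"
  proof -
    have "(3 * real m + 1) * (2 * real m + 1) > 0" by (intro mult_pos_pos) auto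
    moreover have "5 * real m + 1 \<le> (3 * real m + 1) * (2 * real m + 1)" by (simp add: algebra_simps)
    ultimately show ?thesis by simp
  qed
  finally show "p0 + p1 \<le> 1" .
qed (auto simp: p0_def p1_def)

lemma weight_ge: "weight N \<ge> 1" "weight N \<ge> real N + 1"
  by (auto simp: weight_def)

lemma real_div: "real (N div m) = (real N - real (N mod m)) / m"
proof -
  have "real N = real (m * (N div m) + N mod m)" by simp
  then show ?thesis using m unfolding of_nat_add of_nat_mult by (simp add: field_simps)
qed

lemma mod_bounds: "0 \<le> real (N mod m) / m" "real (N mod m) / m \<le> 1"
  using m by (auto simp: field_simps less_imp_le)

lemma weight_eq: "weight N = real N * (real m + 1) / m + 1 - real (N mod m) / m"
  unfolding weight_def real_div using m by (simp add: field_simps)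

lemma weight_conv_sum:
  assumes "d \<in> set_pmf (chain m N)"
  shows "(\<Sum>u<Suc (N div m). real (d u + 1)) = weight N"
proof -
  have "(\<Sum>u<Suc (N div m). real (d u + 1)) = real (\<Sum>u\<le>N div m. d u) + real (N div m) + 1"
    unfolding lessThan_Suc_atMost by (simp add: sum.distrib del: sum.lessThan_Suc)
  then show ?thesis using chain_invariant[OF assms] by (simp add: weight_def)
qed

text \<open>The counts see only whether the chosen node has outdegree 0, 1 or more, so the sum over
  parents collapses to three terms. The increments \<open>p0\<close> and \<open>- p0 + p1\<close>
  common to all of them are the movement of the centre and, for \<open>w1\<close>, the share 1 / m
  of the new node.\<close>

lemma expectation_step:
  fixes F :: "real \<Rightarrow> real \<Rightarrow> 'b :: {banach, second_countable_topology}"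
  assumes d: "d \<in> set_pmf (chain m N)"
  shows "measure_pmf.expectation (pick_parent (Suc (N div m)) d)
       (\<lambda>v. F (w1 (Suc N) (d(v := Suc (d v)))) (w2 (Suc N) (d(v := Suc (d v)))))
    = P0 N d *\<^sub>R F (w1 N d - 1 + p0) (w2 N d + 1 - p0 + p1)
      + P1 N d *\<^sub>R F (w1 N d + p0) (w2 N d - 1 - p0 + p1)
      + (1 - P0 N d - P1 N d) *\<^sub>R F (w1 N d + p0) (w2 N d - p0 + p1)"
proof -
  define n where "n = N div m"
  define FA where "FA = F (w1 N d - 1 + p0) (w2 N d + 1 - p0 + p1)"
  define FB where "FB = F (w1 N d + p0) (w2 N d - 1 - p0 + p1)"
  define FC where "FC = F (w1 N d + p0) (w2 N d - p0 + p1)"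
  have w: "w1 (Suc N) (d(v := Suc (d v))) = w1 N d - of_bool (d v = 0) + p0"
    "w2 (Suc N) (d(v := Suc (d v))) = w2 N d + of_bool (d v = 0) - of_bool (d v = 1) - p0 + p1" if v: "v \<le> n" for v
  proof -
    let ?d = "d(v := Suc (d v))"
    have "?d (Suc n) = 0" using chain_invariant[OF d] v by (auto simp: n_def)
    then have new: "real (outdeg_count k (Suc n) ?d) = real (outdeg_count k n ?d) + of_bool (k = 0)" for k
      by (auto simp: outdeg_count_Suc)
    have upd: "real (outdeg_count 0 n ?d) = real (outdeg_count 0 n d) - of_bool (d v = 0)"
      "real (outdeg_count 1 n ?d) = real (outdeg_count 1 n d) + of_bool (d v = 0) - of_bool (d v = 1)"
      using outdeg_count_upd[OF v, of 0 d] outdeg_count_upd[OF v, of 1 d] by auto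
    \<comment> \<open>When a round ends, the new node adds 1 to the count of outdegree 0 while the
      fraction falls from \<open>1 - 1 / m\<close> to 0; otherwise the fraction rises by
      \<open>1 / m\<close>. The net gain is \<open>1 / m\<close> either way.\<close>
    consider "Suc N div m = Suc n" "m = Suc (N mod m)" "Suc N mod m = 0" | "Suc N div m = n" "Suc N mod m = Suc (N mod m)"
      by (cases "Suc (N mod m) = m") (auto simp: div_Suc mod_Suc n_def)
    then have c: "real (outdeg_count 0 (Suc N div m) ?d) + real (Suc N mod m) / m
        = real (outdeg_count 0 n d) - of_bool (d v = 0) + real (N mod m) / m + 1 / m"
      "real (outdeg_count 1 (Suc N div m) ?d) = real (outdeg_count 1 n d) + of_bool (d v = 0) - of_bool (d v = 1)"
    proof (atomize (full), cases)
      case 1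
      have "real m = real (N mod m) + 1" using arg_cong[OF 1(2), of real] by simp
      then have "real (N mod m) / m + 1 / m = 1" using m by (simp add: add_divide_distrib[symmetric])
      then show "real (outdeg_count 0 (Suc N div m) ?d) + real (Suc N mod m) / m
        = real (outdeg_count 0 n d) - of_bool (d v = 0) + real (N mod m) / m + 1 / m
        \<and> real (outdeg_count 1 (Suc N div m) ?d) = real (outdeg_count 1 n d) + of_bool (d v = 0) - of_bool (d v = 1)"
        unfolding 1(1,3) new upd by simp
    next
      case 2
      then show "real (outdeg_count 0 (Suc N div m) ?d) + real (Suc N mod m) / m
        = real (outdeg_count 0 n d) - of_bool (d v = 0) + real (N mod m) / m + 1 / m
        \<and> real (outdeg_count 1 (Suc N div m) ?d) = real (outdeg_count 1 n d) + of_bool (d v = 0) - of_bool (d v = 1)"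
        unfolding 2 upd by (simp add: add_divide_distrib)
    qed
    have e1: "1 / m - (real m + 1) / (2 * real m + 1) * (real (Suc N) / m) = p0 - (real m + 1) / (2 * real m + 1) * (real N / m)"
      using m unfolding p0_def by (simp add: divide_simps) (simp add: algebra_simps)
    show "w1 (Suc N) ?d = w1 N d - of_bool (d v = 0) + p0"
      unfolding w1_def c n_def[symmetric] using e1 by simp
    have e2: "real m * (real m + 1) / ((3 * real m + 1) * (2 * real m + 1)) * (real (Suc N) / m)
       = real m * (real m + 1) / ((3 * real m + 1) * (2 * real m + 1)) * (real N / m) + p0 - p1"
      using m unfolding p0_def p1_def by (simp add: divide_simps) (simp add: algebra_simps)
    show "w2 (Suc N) ?d = w2 N d + of_bool (d v = 0) - of_bool (d v = 1) - p0 + p1"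
      unfolding w2_def c n_def[symmetric] using e2 by simp
  qed
  have tot: "weight N > 0" using weight_ge[of N] by simp
  have "measure_pmf.expectation (pick_parent (Suc (N div m)) d)
       (\<lambda>v. F (w1 (Suc N) (d(v := Suc (d v)))) (w2 (Suc N) (d(v := Suc (d v)))))
    = (\<Sum>v\<le>n. (real (d v + 1) / weight N) *\<^sub>R F (w1 (Suc N) (d(v := Suc (d v)))) (w2 (Suc N) (d(v := Suc (d v)))))"
    unfolding expectation_pick_parent[OF zero_less_Suc] weight_conv_sum[OF d]
    unfolding lessThan_Suc_atMost n_def ..
  also have "\<dots> = (\<Sum>v\<le>n. (real (d v + 1) / weight N) *\<^sub>R FC
      + ((of_bool (d v = 0) / weight N) *\<^sub>R (FA - FC) + (2 * of_bool (d v = 1) / weight N) *\<^sub>R (FB - FC)))"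
  proof (intro sum.cong refl)
    fix v assume "v \<in> {..n}"
    then show "(real (d v + 1) / weight N) *\<^sub>R F (w1 (Suc N) (d(v := Suc (d v)))) (w2 (Suc N) (d(v := Suc (d v))))
      = (real (d v + 1) / weight N) *\<^sub>R FC
      + ((of_bool (d v = 0) / weight N) *\<^sub>R (FA - FC) + (2 * of_bool (d v = 1) / weight N) *\<^sub>R (FB - FC))"
      by (auto simp: w FA_def FB_def FC_def algebra_simps)
  qed
  also have "\<dots> = ((\<Sum>v<Suc n. real (d v + 1)) / weight N) *\<^sub>R FC + (P0 N d *\<^sub>R (FA - FC) + P1 N d *\<^sub>R (FB - FC))"
    unfolding sum.distrib scaleR_sum_left[symmetric] sum_divide_distrib[symmetric] P0_def P1_def n_def[symmetric]
      outdeg_count_conv_sum sum_distrib_left[symmetric] lessThan_Suc_atMost ..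
  also have "(\<Sum>v<Suc n. real (d v + 1)) / weight N = 1"
    using tot unfolding n_def weight_conv_sum[OF d] by simp
  also have "1 *\<^sub>R FC + (P0 N d *\<^sub>R (FA - FC) + P1 N d *\<^sub>R (FB - FC))
     = P0 N d *\<^sub>R FA + P1 N d *\<^sub>R FB + (1 - P0 N d - P1 N d) *\<^sub>R FC"
    by (simp add: algebra_simps)
  finally show ?thesis unfolding FA_def FB_def FC_def .
qed

text \<open>The errors are pure rounding: with r = (N mod m) / m the weight exceeds (m + 1) N / m by
  1 - r, and \<open>w1\<close> contains the correction r. The numerator for outdegree 0 is, up to
  sign, a convex combination of 1 and \<open>p0\<close>.\<close>

lemma urn_step:
  assumes d: "d \<in> set_pmf (chain m N)"
  shows "urn_step (weight N) p0 p1 (P0 N d) (P1 N d)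
    (- (real (N mod m) / m + p0 * (1 - real (N mod m) / m)) / weight N)
    (- p1 * (1 - real (N mod m) / m) / weight N) (w1 N d) (w2 N d)"
proof
  have tot: "weight N > 0" using weight_ge[of N] by simp
  define r where "r = real (N mod m) / m"
  have r: "0 \<le> r" "r \<le> 1" unfolding r_def using mod_bounds by auto
  have p: "p0 \<le> 1" "p1 \<le> 1" using p_bounds by auto
  have wr: "weight N - 1 + r = (real m + 1) * (real N / m)"
    unfolding weight_eq r_def by (simp add: mult.commute)
  have tp0: "(real m + 1) / (2 * real m + 1) * (real N / m) = p0 * (weight N - 1 + r)"
    unfolding wr p0_def by simp
  have tp1: "2 * (real m * (real m + 1) / ((3 * real m + 1) * (2 * real m + 1)) * (real N / m)) = p1 * (weight N - 1 + r)"
    unfolding wr p1_def by (simp add: mult_ac)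
  show "P0 N d = p0 + w1 N d / weight N + - (real (N mod m) / m + p0 * (1 - real (N mod m) / m)) / weight N"
    unfolding P0_def w1_def tp0 r_def[symmetric] using tot by (simp add: field_simps)
  show "P1 N d = p1 + 2 * w2 N d / weight N + - p1 * (1 - real (N mod m) / m) / weight N"
    unfolding P1_def w2_def right_diff_distrib tp1 r_def[symmetric] using tot by (simp add: field_simps)
  have "r + p0 * (1 - r) \<le> r + 1 * (1 - r)" using p r by (intro add_left_mono mult_right_mono) auto
  moreover have "0 \<le> r + p0 * (1 - r)" using r p_bounds by simp
  ultimately show "\<bar>- (real (N mod m) / m + p0 * (1 - real (N mod m) / m)) / weight N\<bar> \<le> 1 / weight N"
    unfolding r_def[symmetric] using tot by (simp add: divide_right_mono)
  have "p1 * (1 - r) \<le> 1 * 1" "0 \<le> p1 * (1 - r)" using p r p_bounds by (auto intro!: mult_mono mult_le_one)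
  then show "\<bar>- p1 * (1 - real (N mod m) / m) / weight N\<bar> \<le> 1 / weight N"
    unfolding r_def[symmetric] using tot by (simp add: abs_mult divide_right_mono abs_divide)
  have "real (outdeg_count 0 (N div m) d) + 2 * real (outdeg_count 1 (N div m) d)
     = (\<Sum>u<Suc (N div m). of_bool (d u = 0) + 2 * of_bool (d u = 1))"
    unfolding outdeg_count_conv_sum sum.distrib sum_distrib_left lessThan_Suc_atMost ..
  also have "\<dots> \<le> (\<Sum>u<Suc (N div m). real (d u + 1))" by (intro sum_mono) auto
  also have "\<dots> = weight N" by (rule weight_conv_sum[OF d])
  finally show "P0 N d + P1 N d \<le> 1"
    unfolding P0_def P1_def add_divide_distrib[symmetric] using tot by simp
qed (use p_bounds weight_ge[of N] in \<open>auto simp: P0_def P1_def\<close>)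

lemma initial: "w1 0 (\<lambda>_. 0) = 1" "w2 0 (\<lambda>_. 0) = 0"
proof -
  have "{v. v \<le> 0 \<and> (0::nat) = 0} = {0::nat}" "{v. v \<le> 0 \<and> (0::nat) = 1} = ({} :: nat set)" by auto
  then show "w1 0 (\<lambda>_. 0) = 1" "w2 0 (\<lambda>_. 0) = 0" by (auto simp: w1_def w2_def outdeg_count_def)
qed

section \<open>Moment bounds along the chain\<close>

lemma second_moment: "measure_pmf.expectation (chain m N) (\<lambda>d. (w1 N d)\<^sup>2 + (w2 N d)\<^sup>2) \<le> 13 * real N + 1"
proof (induction N)
  case 0
  then show ?case by (simp add: initial)
next
  case (Suc N)
  have "measure_pmf.expectation (chain m (Suc N)) (\<lambda>d. (w1 (Suc N) d)\<^sup>2 + (w2 (Suc N) d)\<^sup>2)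
     \<le> measure_pmf.expectation (chain m N) (\<lambda>d. ((w1 N d)\<^sup>2 + (w2 N d)\<^sup>2) + 13)"
    unfolding expectation_chain_Suc
  proof (intro integral_mono_AE AE_pmfI integrable_chain)
    fix d assume d: "d \<in> set_pmf (chain m N)"
    interpret urn_step "weight N" p0 p1 "P0 N d" "P1 N d"
      "- (real (N mod m) / m + p0 * (1 - real (N mod m) / m)) / weight N"
      "- p1 * (1 - real (N mod m) / m) / weight N" "w1 N d" "w2 N d"
      by (rule urn_step[OF d])
    show "measure_pmf.expectation (pick_parent (Suc (N div m)) d)
        (\<lambda>v. (w1 (Suc N) (d(v := Suc (d v))))\<^sup>2 + (w2 (Suc N) (d(v := Suc (d v))))\<^sup>2)
      \<le> ((w1 N d)\<^sup>2 + (w2 N d)\<^sup>2) + 13"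
      using second_moment_step unfolding expectation_step[OF d, of "\<lambda>x y. x\<^sup>2 + y\<^sup>2"] by simp
  qed
  also have "\<dots> = measure_pmf.expectation (chain m N) (\<lambda>d. (w1 N d)\<^sup>2 + (w2 N d)\<^sup>2) + 13"
    by (subst Bochner_Integration.integral_add) auto
  also have "\<dots> \<le> 13 * real (Suc N) + 1" using Suc.IH by simp
  finally show ?case .
qed

lemma abs_moment: "measure_pmf.expectation (chain m N) (\<lambda>d. \<bar>w1 N d\<bar> + \<bar>w2 N d\<bar>) \<le> 14 * sqrt (real N + 1)"
proof -
  \<comment> \<open>\<open>R\<close> is the order of magnitude of the centred counts; dividing the
    squares by it turns the second moment into a bound for the first by the arithmetic-geometric
    inequality.\<close>
  define R where "R = sqrt (real N + 1)"
  have R: "R > 0" "R * R = real N + 1" by (auto simp: R_def)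
  have "measure_pmf.expectation (chain m N) (\<lambda>d. \<bar>w1 N d\<bar> + \<bar>w2 N d\<bar>)
     \<le> measure_pmf.expectation (chain m N) (\<lambda>d. ((w1 N d)\<^sup>2 + (w2 N d)\<^sup>2) / R + R)"
  proof (intro integral_mono integrable_chain)
    fix d
    have 1: "\<bar>x\<bar> \<le> x\<^sup>2 / R + R / 2" for x :: real
    proof -
      have "0 \<le> (\<bar>x\<bar> - R)\<^sup>2" by simp
      then have "2 * \<bar>x\<bar> * R \<le> x\<^sup>2 + R * R" by (simp add: power2_eq_square algebra_simps)
      also have "\<dots> \<le> 2 * x\<^sup>2 + R * R" by simp
      finally show ?thesis using R(1) by (simp add: field_simps)
    qed
    show "\<bar>w1 N d\<bar> + \<bar>w2 N d\<bar> \<le> ((w1 N d)\<^sup>2 + (w2 N d)\<^sup>2) / R + R"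
      using 1[of "w1 N d"] 1[of "w2 N d"] by (simp add: add_divide_distrib)
  qed
  also have "\<dots> = measure_pmf.expectation (chain m N) (\<lambda>d. (w1 N d)\<^sup>2 + (w2 N d)\<^sup>2) / R + R"
    by (subst Bochner_Integration.integral_add) auto
  also have "\<dots> \<le> 13 * (R * R) / R + R"
    using second_moment[of N] R by (intro add_right_mono divide_right_mono) auto
  also have "\<dots> = 14 * R" using R(1) by simp
  finally show ?thesis by (simp add: R_def)
qed

section \<open>Recursion for the characteristic function\<close>

definition "phi N s t = measure_pmf.expectation (chain m N) (\<lambda>d. cis (s * w1 N d + t * w2 N d))"

text \<open>The average of \<open>char_step\<close> over the chain: as \<open>weight N\<close> is
  not random, the drift factor is absorbed into \<open>phi N\<close> at shifted frequencies. The
  constant 322 is 23 * 14, with 14 from \<open>abs_moment\<close>.\<close>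

lemma phi_step:
  assumes st: "\<bar>s\<bar> \<le> \<tau>" "\<bar>t\<bar> \<le> \<tau>" "\<tau> \<le> 1"
  shows "norm (phi (Suc N) s t
      - phi N (s + (t - s) / weight N) (t - 2 * t / weight N) * complex_of_real (1 - step_variance p0 p1 s t / 2))
    \<le> 322 * (\<tau> ^ 3 + \<tau> / (real N + 1) + \<tau>\<^sup>2 / sqrt (real N + 1))"
proof -
  define S where "S = weight N"
  have S: "S \<ge> 1" "S \<ge> real N + 1" unfolding S_def using weight_ge by auto
  have \<tau>: "\<tau> \<ge> 0" using st by simp
  define V where "V = complex_of_real (1 - step_variance p0 p1 s t / 2)"
  define J where "J d = P0 N d *\<^sub>R cis (s * (- 1 + p0) + t * (1 - p0 + p1)) + P1 N d *\<^sub>R cis (s * p0 + t * (- 1 - p0 + p1))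
      + (1 - P0 N d - P1 N d) *\<^sub>R cis (s * p0 + t * (- p0 + p1))" for d
  have "phi (Suc N) s t = measure_pmf.expectation (chain m N) (\<lambda>d. cis (s * w1 N d + t * w2 N d) * J d)"
    unfolding phi_def expectation_chain_Suc
  proof (intro integral_cong_AE AE_pmfI)
    fix d assume d: "d \<in> set_pmf (chain m N)"
    have c: "cis (s * (w1 N d - 1 + p0) + t * (w2 N d + 1 - p0 + p1)) = cis (s * w1 N d + t * w2 N d) * cis (s * (- 1 + p0) + t * (1 - p0 + p1))"
      "cis (s * (w1 N d + p0) + t * (w2 N d - 1 - p0 + p1)) = cis (s * w1 N d + t * w2 N d) * cis (s * p0 + t * (- 1 - p0 + p1))"
      "cis (s * (w1 N d + p0) + t * (w2 N d - p0 + p1)) = cis (s * w1 N d + t * w2 N d) * cis (s * p0 + t * (- p0 + p1))"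
      unfolding cis_mult by (simp_all add: algebra_simps)
    show "measure_pmf.expectation (pick_parent (Suc (N div m)) d)
        (\<lambda>v. cis (s * w1 (Suc N) (d(v := Suc (d v))) + t * w2 (Suc N) (d(v := Suc (d v)))))
      = cis (s * w1 N d + t * w2 N d) * J d"
      unfolding expectation_step[OF d, of "\<lambda>x y. cis (s * x + t * y)"] c J_def
      by (simp add: distrib_left)
  qed auto
  moreover have "phi N (s + (t - s) / S) (t - 2 * t / S) * V
    = measure_pmf.expectation (chain m N) (\<lambda>d. cis (s * w1 N d + t * w2 N d) * (cis (((t - s) * w1 N d - 2 * t * w2 N d) / S) * V))"
  proof -
    have "cis ((s + (t - s) / S) * x + (t - 2 * t / S) * y) * V = cis (s * x + t * y) * (cis (((t - s) * x - 2 * t * y) / S) * V)" for x y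
    proof -
      have "(s + (t - s) / S) * x + (t - 2 * t / S) * y = s * x + t * y + ((t - s) * x - 2 * t * y) / S"
        using S by (simp add: field_simps)
      then show ?thesis by (simp only: cis_mult[symmetric] mult.assoc)
    qed
    note * = this
    show ?thesis
      unfolding phi_def by (subst integral_mult_left_zero[symmetric]) (simp only: *)
  qed
  ultimately have eq: "phi (Suc N) s t - phi N (s + (t - s) / S) (t - 2 * t / S) * V
    = measure_pmf.expectation (chain m N)
        (\<lambda>d. cis (s * w1 N d + t * w2 N d) * (J d - cis (((t - s) * w1 N d - 2 * t * w2 N d) / S) * V))"
    by (simp add: right_diff_distrib)
  have "norm (phi (Suc N) s t - phi N (s + (t - s) / S) (t - 2 * t / S) * V) \<le> measure_pmf.expectation (chain m N)
        (\<lambda>d. norm (cis (s * w1 N d + t * w2 N d) * (J d - cis (((t - s) * w1 N d - 2 * t * w2 N d) / S) * V)))"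
    unfolding eq by (rule integral_norm_bound)
  also have "\<dots> \<le> measure_pmf.expectation (chain m N)
        (\<lambda>d. 23 * (\<tau> ^ 3 + \<tau> / S + \<tau>\<^sup>2 * (\<bar>w1 N d\<bar> + \<bar>w2 N d\<bar>) / S))"
  proof (intro integral_mono_AE AE_pmfI integrable_chain)
    fix d assume d: "d \<in> set_pmf (chain m N)"
    interpret urn_step "weight N" p0 p1 "P0 N d" "P1 N d"
      "- (real (N mod m) / m + p0 * (1 - real (N mod m) / m)) / weight N"
      "- p1 * (1 - real (N mod m) / m) / weight N" "w1 N d" "w2 N d"
      by (rule urn_step[OF d])
    show "norm (cis (s * w1 N d + t * w2 N d) * (J d - cis (((t - s) * w1 N d - 2 * t * w2 N d) / S) * V))
      \<le> 23 * (\<tau> ^ 3 + \<tau> / S + \<tau>\<^sup>2 * (\<bar>w1 N d\<bar> + \<bar>w2 N d\<bar>) / S)"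
      using char_step[OF st] by (simp add: norm_mult J_def V_def S_def)
  qed
  also have "\<dots> = 23 * (\<tau> ^ 3 + \<tau> / S + \<tau>\<^sup>2 / S * measure_pmf.expectation (chain m N) (\<lambda>d. \<bar>w1 N d\<bar> + \<bar>w2 N d\<bar>))"
    by (simp add: add_divide_distrib distrib_left)
  also have "\<dots> \<le> 23 * (\<tau> ^ 3 + \<tau> / (real N + 1) + \<tau>\<^sup>2 / (real N + 1) * (14 * sqrt (real N + 1)))"
    using S \<tau> abs_moment[of N] by (intro mult_left_mono add_mono mult_mono divide_left_mono) auto
  also have "\<dots> = 23 * (\<tau> ^ 3 + \<tau> / (real N + 1) + 14 * (\<tau>\<^sup>2 / sqrt (real N + 1)))"
  proof -
    have "sqrt (real N + 1) / (real N + 1) = 1 / sqrt (real N + 1)"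
      using sqrt_divide_self_eq[of "real N + 1"] by (simp add: inverse_eq_divide)
    then have "\<tau>\<^sup>2 / (real N + 1) * (14 * sqrt (real N + 1)) = 14 * (\<tau>\<^sup>2 / sqrt (real N + 1))"
      by (metis (no_types, opaque_lifting) mult.commute mult.left_commute mult.right_neutral times_divide_eq_left times_divide_eq_right)
    then show ?thesis by (simp only:)
  qed
  also have "\<dots> \<le> 322 * (\<tau> ^ 3 + \<tau> / (real N + 1) + \<tau>\<^sup>2 / sqrt (real N + 1))"
  proof -
    have "0 \<le> \<tau> ^ 3" "0 \<le> \<tau> / (real N + 1)" using \<tau> by auto
    then show ?thesis by argo
  qed
  finally show ?thesis unfolding S_def V_def .
qed

section \<open>The limiting covariance and its Lyapunov equation\<close>

definition "var0 = 2 * (real m)\<^sup>2 * (real m + 1) / ((3 * real m + 1) * (2 * real m + 1)\<^sup>2)"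
definition "cov01 = - (4 * (real m + 1)\<^sup>2 * (real m)\<^sup>2 / ((4 * real m + 1) * (3 * real m + 1) * (2 * real m + 1)\<^sup>2))"
definition "var1 = 2 * (real m)\<^sup>2 * (real m + 1) * (48 * real m ^ 3 + 59 * (real m)\<^sup>2 + 27 * real m + 4)
  / ((5 * real m + 1) * (4 * real m + 1) * (3 * real m + 1)\<^sup>2 * (2 * real m + 1)\<^sup>2)"
definition "cov_form s t = var0 * s\<^sup>2 + 2 * cov01 * s * t + var1 * t\<^sup>2"

lemma var0_pos: "var0 > 0"
  unfolding var0_def using m by (intro divide_pos_pos mult_pos_pos) auto

lemma cov_det_pos: "var0 * var1 - cov01\<^sup>2 > 0"
proof -
  define M where "M = real m"
  have M: "M \<ge> 1" using m by (simp add: M_def)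
  \<comment> \<open>To be read with \<open>p\<close> = M^2, \<open>u\<close> = M + 1,
    \<open>b\<close>, \<open>c\<close>, \<open>d\<close>, \<open>e\<close> = 2 M + 1, ..., 5 M + 1
    and \<open>P\<close> the cubic in \<open>var1\<close>. The last factor decides the sign; it is a
    polynomial in M with positive coefficients.\<close>
  have alg: "2 * p * u / (c * b\<^sup>2) * (2 * p * u * P / (e * d * c\<^sup>2 * b\<^sup>2)) - (- (4 * u\<^sup>2 * p / (d * c * b\<^sup>2)))\<^sup>2
     = 4 * p\<^sup>2 * u\<^sup>2 / (e * d\<^sup>2 * c ^ 3 * b ^ 4) * (P * d - 4 * u\<^sup>2 * e * c)"
    if "b > 0" "c > 0" "d > 0" "e > 0" for b c d e p u P :: real
    using that by (simp add: field_simps power2_eq_square power3_eq_cube power4_eq_xxxx)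
  have "(48 * M ^ 3 + 59 * M\<^sup>2 + 27 * M + 4) * (4 * M + 1) - 4 * (M + 1)\<^sup>2 * (5 * M + 1) * (3 * M + 1)
     = 132 * M ^ 4 + 132 * M ^ 3 + 39 * M\<^sup>2 + 3 * M"
    by (simp add: algebra_simps power2_eq_square power3_eq_cube power4_eq_xxxx)
  also have "\<dots> > 0" using M by (intro add_pos_pos mult_pos_pos) auto
  finally show ?thesis
    unfolding var0_def var1_def cov01_def M_def[symmetric] using M
    by (subst alg) (auto intro!: mult_pos_pos divide_pos_pos)
qed

lemma cov_form_nonneg: "cov_form s t \<ge> 0"
proof -
  have "var0 * cov_form s t = (var0 * s + cov01 * t)\<^sup>2 + (var0 * var1 - cov01\<^sup>2) * t\<^sup>2"
    by (simp add: cov_form_def power2_eq_square algebra_simps)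
  also have "\<dots> \<ge> 0" using cov_det_pos by simp
  finally show ?thesis using var0_pos by (simp add: zero_le_mult_iff)
qed

text \<open>The coefficients of \<open>s\<^sup>2\<close>, \<open>s * t\<close> and
  \<open>t\<^sup>2\<close> give \<open>h1\<close>, \<open>h2\<close> and \<open>h3\<close>. This
  system is triangular, as the drift is: \<open>h1\<close> determines \<open>var0\<close>, then
  \<open>h2\<close> determines \<open>cov01\<close>, then \<open>h3\<close> determines
  \<open>var1\<close>.\<close>

lemma lyapunov_equation:
  "cov_form s t / real m
     - 2 / (real m + 1) * (var0 * s * (t - s) + cov01 * (s * (- 2 * t) + t * (t - s)) + var1 * t * (- 2 * t))
    = step_variance p0 p1 s t"
proof -
  define M where "M = real m"
  have M: "M \<ge> 1" using m by (simp add: M_def)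
  have pos: "M > 0" "M + 1 > 0" "2 * M + 1 > 0" "3 * M + 1 > 0" "4 * M + 1 > 0" "5 * M + 1 > 0" using M by auto
  have p0: "p0 = 1 / (2 * M + 1)" and p1: "p1 = 2 * M / ((3 * M + 1) * (2 * M + 1))"
    by (simp_all add: p0_def p1_def M_def)
  have s0: "p0 + p1 = (5 * M + 1) / ((3 * M + 1) * (2 * M + 1))" and d0: "p0 - p1 = (M + 1) / ((3 * M + 1) * (2 * M + 1))"
    unfolding p0 p1 using pos by (simp_all add: divide_simps)
  have h1: "var0 / M + 2 / (M + 1) * var0 = p0 - p0\<^sup>2"
  proof -
    have "1 / M + 2 / (M + 1) = (3 * M + 1) / (M * (M + 1))" using pos by (simp add: field_simps)
    then have "var0 / M + 2 / (M + 1) * var0 = var0 * ((3 * M + 1) / (M * (M + 1)))"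
      by (metis distrib_left mult.commute mult.right_neutral times_divide_eq_right)
    also have "\<dots> = 2 * M / (2 * M + 1)\<^sup>2"
      unfolding var0_def M_def[symmetric] using pos by (simp add: divide_simps) (simp add: power2_eq_square)
    also have "\<dots> = p0 - p0\<^sup>2" unfolding p0 using pos by (simp add: divide_simps) (simp add: power2_eq_square algebra_simps)
    finally show ?thesis .
  qed
  have h2: "cov01 / M - 1 / (M + 1) * (var0 - 3 * cov01) = - p0 + p0 * (p0 - p1)"
  proof -
    have "1 / M + 3 / (M + 1) = (4 * M + 1) / (M * (M + 1))" using pos by (simp add: field_simps)
    moreover have "cov01 / M - 1 / (M + 1) * (var0 - 3 * cov01) = cov01 * (1 / M + 3 / (M + 1)) - var0 / (M + 1)"
      by (simp add: algebra_simps diff_divide_distrib)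
    ultimately have "cov01 / M - 1 / (M + 1) * (var0 - 3 * cov01) = cov01 * ((4 * M + 1) / (M * (M + 1))) - var0 / (M + 1)"
      by simp
    also have "cov01 * ((4 * M + 1) / (M * (M + 1))) = - (4 * (M + 1) * M) / ((3 * M + 1) * (2 * M + 1)\<^sup>2)"
      unfolding cov01_def M_def[symmetric] using pos by (simp add: divide_simps) (simp add: power2_eq_square)
    also have "var0 / (M + 1) = 2 * M\<^sup>2 / ((3 * M + 1) * (2 * M + 1)\<^sup>2)"
      unfolding var0_def M_def[symmetric] using pos by simp
    also have "- (4 * (M + 1) * M) / ((3 * M + 1) * (2 * M + 1)\<^sup>2) - 2 * M\<^sup>2 / ((3 * M + 1) * (2 * M + 1)\<^sup>2)
       = - p0 + p0 * (p0 - p1)"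
      unfolding d0 unfolding p0 using pos by (simp add: divide_simps) (simp add: power2_eq_square algebra_simps)
    finally show ?thesis .
  qed
  have h3: "var1 / M - 2 / (M + 1) * (cov01 - 2 * var1) = p0 + p1 - (p0 - p1)\<^sup>2"
  proof -
    have "1 / M + 4 / (M + 1) = (5 * M + 1) / (M * (M + 1))" using pos by (simp add: field_simps)
    moreover have "var1 / M - 2 / (M + 1) * (cov01 - 2 * var1) = var1 * (1 / M + 4 / (M + 1)) - 2 * cov01 / (M + 1)"
      by (simp add: algebra_simps diff_divide_distrib)
    ultimately have "var1 / M - 2 / (M + 1) * (cov01 - 2 * var1) = var1 * ((5 * M + 1) / (M * (M + 1))) - 2 * cov01 / (M + 1)"
      by simp
    also have "var1 * ((5 * M + 1) / (M * (M + 1)))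
        = 2 * M * (48 * M ^ 3 + 59 * M\<^sup>2 + 27 * M + 4) / ((4 * M + 1) * (3 * M + 1)\<^sup>2 * (2 * M + 1)\<^sup>2)"
    proof -
      have "2 * M\<^sup>2 * u * P / (e * d * c * b) * (e / (M * u)) = 2 * M * P / (d * c * b)"
        if "u > 0" "e > 0" for u e d c b P :: real
        using that pos(1) by (simp add: power2_eq_square)
      then show ?thesis unfolding var1_def M_def[symmetric] using pos by blast
    qed
    also have "2 * cov01 / (M + 1) = - (8 * (M + 1) * M\<^sup>2 / ((4 * M + 1) * (3 * M + 1) * (2 * M + 1)\<^sup>2))"
    proof -
      have "2 * (- (4 * u\<^sup>2 * x / y)) / u = - (8 * u * x / y)" if "u > 0" for u x y :: real
        using that by (simp add: power2_eq_square)
      then show ?thesis unfolding cov01_def M_def[symmetric] using pos by blast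
    qed
    also have "2 * M * (48 * M ^ 3 + 59 * M\<^sup>2 + 27 * M + 4) / ((4 * M + 1) * (3 * M + 1)\<^sup>2 * (2 * M + 1)\<^sup>2)
        - - (8 * (M + 1) * M\<^sup>2 / ((4 * M + 1) * (3 * M + 1) * (2 * M + 1)\<^sup>2))
       = (2 * M * (48 * M ^ 3 + 59 * M\<^sup>2 + 27 * M + 4) + 8 * (M + 1) * M\<^sup>2 * (3 * M + 1))
          / ((4 * M + 1) * (3 * M + 1)\<^sup>2 * (2 * M + 1)\<^sup>2)"
    proof -
      have "A / (d * c\<^sup>2 * b) - - (B / (d * c * b)) = (A + B * c) / (d * c\<^sup>2 * b)" if "d > 0" "c > 0" "b > 0" for A B b c d :: real
        using that by (simp add: field_simps power2_eq_square)
      then show ?thesis using pos by (simp only: zero_less_power)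
    qed
    also have "2 * M * (48 * M ^ 3 + 59 * M\<^sup>2 + 27 * M + 4) + 8 * (M + 1) * M\<^sup>2 * (3 * M + 1)
        = (4 * M + 1) * ((5 * M + 1) * ((3 * M + 1) * (2 * M + 1)) - (M + 1)\<^sup>2)"
      by (simp add: algebra_simps power2_eq_square power3_eq_cube)
    also have "(4 * M + 1) * ((5 * M + 1) * ((3 * M + 1) * (2 * M + 1)) - (M + 1)\<^sup>2) / ((4 * M + 1) * (3 * M + 1)\<^sup>2 * (2 * M + 1)\<^sup>2)
        = p0 + p1 - (p0 - p1)\<^sup>2"
    proof -
      have "d * (e * (c * b) - x) / (d * c\<^sup>2 * b\<^sup>2) = e / (c * b) - x / (c * b)\<^sup>2"
        if "d > 0" "c > 0" "b > 0" for b c d e x :: real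
        using that by (simp add: field_simps power2_eq_square)
      then show ?thesis unfolding s0 d0 power_divide using pos by blast
    qed
    finally show ?thesis .
  qed
  have "cov_form s t / M
     - 2 / (M + 1) * (var0 * s * (t - s) + cov01 * (s * (- 2 * t) + t * (t - s)) + var1 * t * (- 2 * t))
    = (var0 / M + 2 / (M + 1) * var0) * s\<^sup>2 + 2 * (cov01 / M - 1 / (M + 1) * (var0 - 3 * cov01)) * (s * t)
      + (var1 / M - 2 / (M + 1) * (cov01 - 2 * var1)) * t\<^sup>2"
    unfolding cov_form_def divide_inverse by (simp add: algebra_simps power2_eq_square)
  also have "\<dots> = step_variance p0 p1 s t"
    unfolding h1 h2 h3 step_variance_def by (simp add: algebra_simps power2_eq_square)
  finally show ?thesis unfolding M_def .
qed

text \<open>The frequencies are general in the induction because the recursion moves them. The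
  earlier error is multiplied by \<open>V\<close>, of absolute value at most 1, and each choice adds
  two new errors: 322 in the constant comes from \<open>phi_step\<close>, the rest from
  \<open>gauss_step\<close>.\<close>

lemma phi_approx:
  assumes "\<bar>s\<bar> \<le> \<tau>" "\<bar>t\<bar> \<le> \<tau>" "\<tau> \<le> 1"
  shows "norm (phi N s t - complex_of_real (exp (- (real N / m * cov_form s t / 2))))
    \<le> \<tau> + (326 + 4 * (\<bar>var0\<bar> + 2 * \<bar>cov01\<bar> + \<bar>var1\<bar>))
        * (\<Sum>k<N. \<tau> ^ 3 + \<tau> / (real k + 1) + \<tau>\<^sup>2 / sqrt (real k + 1))"
  using assms
proof (induction N arbitrary: s t)
  case 0
  \<comment> \<open>The chain starts at (\<open>w1\<close>, \<open>w2\<close>) = (1, 0) and not at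
    the origin; this offset is the summand \<open>\<tau>\<close> of the bound.\<close>
  have "norm (cis s - 1) \<le> \<tau>" using norm_cis_approx(1)[of s] 0 by simp
  then show ?case by (simp add: phi_def initial)
next
  case (Suc N)
  define S where "S = weight N"
  define K where "K = 4 * (\<bar>var0\<bar> + 2 * \<bar>cov01\<bar> + \<bar>var1\<bar>) + 4"
  define s' t' where "s' = s + (t - s) / S" and "t' = t - 2 * t / S"
  define V where "V = 1 - step_variance p0 p1 s t / 2"
  define G where "G N s t = exp (- (real N / m * cov_form s t / 2))" for N s t
  define E where "E k = \<tau> ^ 3 + \<tau> / (real k + 1) + \<tau>\<^sup>2 / sqrt (real k + 1)" for k
  have \<tau>: "\<tau> \<ge> 0" using Suc.prems by simp
  have S: "S \<ge> 1" "S \<ge> real N + 1" unfolding S_def using weight_ge by auto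
  have s't': "\<bar>s'\<bar> \<le> \<tau>" "\<bar>t'\<bar> \<le> \<tau>"
  proof -
    have r: "0 \<le> 1 / S" "1 / S \<le> 1" using S by auto
    \<comment> \<open>\<open>s'\<close> is a convex combination of \<open>s\<close> and
      \<open>t\<close>, and \<open>t'\<close> is \<open>t\<close> times a factor in [-1, 1], both
      because \<open>S \<ge> 1\<close>.\<close>
    have "\<bar>s'\<bar> = \<bar>(1 - 1 / S) * s + 1 / S * t\<bar>" using S by (simp add: s'_def field_simps)
    also have "\<dots> \<le> (1 - 1 / S) * \<bar>s\<bar> + 1 / S * \<bar>t\<bar>"
      using r by (intro order.trans[OF abs_triangle_ineq] add_mono) (auto simp: abs_mult)
    also have "\<dots> \<le> (1 - 1 / S) * \<tau> + 1 / S * \<tau>" using r Suc.prems by (intro add_mono mult_left_mono) auto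
    finally show "\<bar>s'\<bar> \<le> \<tau>" by (simp add: algebra_simps)
    have "\<bar>t'\<bar> = \<bar>1 - 2 / S\<bar> * \<bar>t\<bar>" unfolding abs_mult[symmetric] using S by (simp add: t'_def field_simps)
    also have "\<dots> \<le> 1 * \<tau>"
    proof (intro mult_mono)
      show "\<bar>1 - 2 / S\<bar> \<le> 1" using S by (simp add: field_simps abs_le_iff)
    qed (use Suc.prems in auto)
    finally show "\<bar>t'\<bar> \<le> \<tau>" by simp
  qed
  have V: "\<bar>V\<bar> \<le> 1"
  proof -
    have "\<tau>\<^sup>2 \<le> 1" using \<tau> Suc.prems(3) by (simp add: power_le_one)
    then show ?thesis unfolding V_def using step_variance_bounds[OF p_bounds Suc.prems(1,2)] by linarith
  qed
  have g: "\<bar>G (Suc N) s t - G N s' t' * V\<bar> \<le> K * (\<tau> ^ 3 + \<tau> / S)"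
    unfolding G_def V_def s'_def t'_def K_def cov_form_def of_nat_Suc add.commute[of 1]
  proof (rule gauss_step[OF p_bounds])
    show "\<bar>real N * (real m + 1) / real m - S\<bar> \<le> 1"
      unfolding S_def weight_eq using mod_bounds[of N] by linarith
  qed (use cov_form_nonneg lyapunov_equation m S Suc.prems in \<open>auto simp: cov_form_def\<close>)
  have "norm (phi (Suc N) s t - complex_of_real (G (Suc N) s t))
    = norm ((phi (Suc N) s t - phi N s' t' * complex_of_real V) + (phi N s' t' - complex_of_real (G N s' t')) * complex_of_real V
       - complex_of_real (G (Suc N) s t - G N s' t' * V))"
    by (simp add: algebra_simps)
  also have "\<dots> \<le> norm (phi (Suc N) s t - phi N s' t' * complex_of_real V)
      + norm (phi N s' t' - complex_of_real (G N s' t')) * \<bar>V\<bar> + \<bar>G (Suc N) s t - G N s' t' * V\<bar>"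
  proof -
    have "norm (A + B * complex_of_real V - complex_of_real x) \<le> norm A + norm B * \<bar>V\<bar> + \<bar>x\<bar>" for A B x
      using norm_triangle_ineq4[of "A + B * complex_of_real V" "complex_of_real x"]
        norm_triangle_ineq[of A "B * complex_of_real V"] by (simp add: norm_mult)
    then show ?thesis .
  qed
  also have "\<dots> \<le> 322 * E N + (\<tau> + (326 + 4 * (\<bar>var0\<bar> + 2 * \<bar>cov01\<bar> + \<bar>var1\<bar>)) * (\<Sum>k<N. E k)) * 1 + K * E N"
  proof (intro add_mono mult_mono)
    show "norm (phi (Suc N) s t - phi N s' t' * complex_of_real V) \<le> 322 * E N"
      unfolding E_def s'_def t'_def S_def V_def by (rule phi_step[OF Suc.prems])
    show "norm (phi N s' t' - complex_of_real (G N s' t'))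
       \<le> \<tau> + (326 + 4 * (\<bar>var0\<bar> + 2 * \<bar>cov01\<bar> + \<bar>var1\<bar>)) * (\<Sum>k<N. E k)"
      using Suc.IH[OF s't' Suc.prems(3)] by (simp add: G_def E_def)
    have "\<tau> / S \<le> \<tau> / (real N + 1)" using S \<tau> by (intro divide_left_mono) auto
    then have "\<tau> ^ 3 + \<tau> / S \<le> E N" using \<tau> by (simp add: E_def add_increasing2)
    then have "K * (\<tau> ^ 3 + \<tau> / S) \<le> K * E N" by (intro mult_left_mono) (auto simp: K_def)
    with g show "\<bar>G (Suc N) s t - G N s' t' * V\<bar> \<le> K * E N" by simp
    show "0 \<le> \<tau> + (326 + 4 * (\<bar>var0\<bar> + 2 * \<bar>cov01\<bar> + \<bar>var1\<bar>)) * (\<Sum>k<N. E k)"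
      using \<tau> by (intro add_nonneg_nonneg mult_nonneg_nonneg sum_nonneg) (auto simp: E_def)
  qed (use V in auto)
  also have "\<dots> = \<tau> + (326 + 4 * (\<bar>var0\<bar> + 2 * \<bar>cov01\<bar> + \<bar>var1\<bar>)) * (\<Sum>k<Suc N. E k)"
    by (simp add: K_def algebra_simps)
  finally show ?case unfolding G_def E_def .
qed

end

section \<open>The limit theorem\<close>

lemma sum_inverse_sqrt_le: "(\<Sum>k<N. 1 / sqrt (real k + 1)) \<le> 2 * sqrt (real N)"
proof (induction N)
  case (Suc N)
  have "1 / sqrt (real N + 1) \<le> 2 * sqrt (real N + 1) - 2 * sqrt (real N)"
  proof -
    have "1 = (sqrt (real N + 1) - sqrt (real N)) * (sqrt (real N + 1) + sqrt (real N))"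
      by (simp add: algebra_simps)
    also have "\<dots> \<le> (sqrt (real N + 1) - sqrt (real N)) * (2 * sqrt (real N + 1))"
      by (intro mult_left_mono) auto
    finally show ?thesis by (simp add: field_simps)
  qed
  with Suc.IH show ?case by (simp add: add.commute)
qed simp

lemma sum_inverse_le: "(\<Sum>k<N. 1 / (real k + 1)) \<le> 1 + ln (real N + 1)"
proof -
  \<comment> \<open>Induction on the original claim would need 1 / (N + 1) to be at most ln (N + 2)
    - ln (N + 1), which is false. With one more summand the new term is 1 / (N + 2), which does
    satisfy this bound.\<close>
  have "(\<Sum>k<Suc N. 1 / (real k + 1)) \<le> 1 + ln (real N + 1)" for N
  proof (induction N)
    case (Suc N)
    have "1 / (real N + 2) \<le> ln (real N + 2) - ln (real N + 1)"
    proof -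
      have "ln ((real N + 1) / (real N + 2)) \<le> (real N + 1) / (real N + 2) - 1"
        by (rule ln_le_minus_one) simp
      then show ?thesis by (simp add: ln_div field_simps)
    qed
    with Suc.IH show ?case by (simp add: add.commute)
  qed simp
  from this[of N] show ?thesis by (rule order.trans[rotated]) simp
qed

context circuit
begin

text \<open>\<open>cov_form\<close> is homogeneous of degree 2, so after n m choices the scaling by
  1 / sqrt n cancels the factor \<open>N / m\<close> exactly.\<close>

lemma phi_tendsto:
  "(\<lambda>n. phi (n * m) (s / sqrt (real n)) (t / sqrt (real n))) \<longlonglongrightarrow> complex_of_real (exp (- cov_form s t / 2))"
proof -
  define T where "T = max \<bar>s\<bar> \<bar>t\<bar>"
  define K where "K = 326 + 4 * (\<bar>var0\<bar> + 2 * \<bar>cov01\<bar> + \<bar>var1\<bar>)"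
  \<comment> \<open>The bound of \<open>phi_approx\<close> at tau = T / sqrt n and N = n m. The
    estimate N + 1 <= 2 m n splits the logarithm, and \<open>powr (1 / 2)\<close> puts its growing
    part in the form of \<open>lim_ln_over_power\<close>.\<close>
  define B where "B n = T / sqrt (real n) + K * (real m * T ^ 3 / sqrt (real n)
      + T * (1 / sqrt (real n) + ln (2 * real m) / sqrt (real n) + ln (real n) / real n powr (1 / 2)) + 2 * sqrt (real m) * T\<^sup>2 / sqrt (real n))" for n
  have T: "0 \<le> T" "\<bar>s\<bar> \<le> T" "\<bar>t\<bar> \<le> T" by (auto simp: T_def)
  have K: "K \<ge> 0" by (simp add: K_def)
  have sq: "(\<lambda>n. c / sqrt (real n)) \<longlonglongrightarrow> 0" for c
    by (intro tendsto_divide_0[OF tendsto_const] filterlim_at_top_imp_at_infinity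
        filterlim_compose[OF sqrt_at_top filterlim_real_sequentially])
  have "B \<longlonglongrightarrow> 0 + K * (0 + T * (0 + 0 + 0) + 0)"
    unfolding B_def by (intro tendsto_intros sq lim_ln_over_power) auto
  then have B: "B \<longlonglongrightarrow> 0" by simp
  have "eventually (\<lambda>n. norm (T / sqrt (real n)) < 1) sequentially"
    using tendstoD[OF sq[of T], of 1] by simp
  then have "eventually (\<lambda>n. norm (phi (n * m) (s / sqrt (real n)) (t / sqrt (real n)) - complex_of_real (exp (- cov_form s t / 2))) \<le> B n) sequentially"
    using eventually_gt_at_top[of 0]
  proof eventually_elim
    case (elim n)
    define \<tau> where "\<tau> = T / sqrt (real n)"
    define N where "N = n * m"
    have n: "n \<ge> 1" "real n > 0" using elim by auto
    have \<tau>: "0 \<le> \<tau>" "\<tau> \<le> 1" using elim T by (auto simp: \<tau>_def)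
    have le: "\<bar>s / sqrt (real n)\<bar> \<le> \<tau>" "\<bar>t / sqrt (real n)\<bar> \<le> \<tau>"
      unfolding \<tau>_def using T by (auto simp: abs_divide intro!: divide_right_mono)
    have "real (n * m) / m * cov_form (s / sqrt (real n)) (t / sqrt (real n)) = cov_form s t"
      using n m by (simp add: cov_form_def power_divide field_simps)
    then have "norm (phi N (s / sqrt (real n)) (t / sqrt (real n)) - complex_of_real (exp (- cov_form s t / 2)))
      \<le> \<tau> + K * (\<Sum>k<N. \<tau> ^ 3 + \<tau> / (real k + 1) + \<tau>\<^sup>2 / sqrt (real k + 1))"
      using phi_approx[OF le \<tau>(2), of N] unfolding K_def N_def by simp
    also have "(\<Sum>k<N. \<tau> ^ 3 + \<tau> / (real k + 1) + \<tau>\<^sup>2 / sqrt (real k + 1))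
       = real N * \<tau> ^ 3 + \<tau> * (\<Sum>k<N. 1 / (real k + 1)) + \<tau>\<^sup>2 * (\<Sum>k<N. 1 / sqrt (real k + 1))"
      by (simp add: sum.distrib sum_distrib_left)
    also have "\<tau> + K * (real N * \<tau> ^ 3 + \<tau> * (\<Sum>k<N. 1 / (real k + 1)) + \<tau>\<^sup>2 * (\<Sum>k<N. 1 / sqrt (real k + 1)))
      \<le> \<tau> + K * (real N * \<tau> ^ 3 + \<tau> * (1 + (ln (2 * real m) + ln (real n))) + \<tau>\<^sup>2 * (2 * sqrt (real N)))"
    proof (intro add_left_mono mult_left_mono add_mono sum_inverse_sqrt_le order.trans[OF sum_inverse_le])
      have "real N + 1 \<le> 2 * real m * real n"
      proof -
        have "1 \<le> n * m" using n m by simp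
        then have "1 \<le> real (n * m)" by linarith
        then show ?thesis by (simp add: N_def mult.commute)
      qed
      then have "ln (real N + 1) \<le> ln (2 * real m * real n)" by simp
      also have "\<dots> = ln (2 * real m) + ln (real n)" using n m by (subst ln_mult) auto
      finally show "ln (real N + 1) \<le> ln (2 * real m) + ln (real n)" .
    qed (use \<tau> K in auto)
    also have "\<dots> = B n"
    proof -
      have 1: "real N * \<tau> ^ 3 = real m * T ^ 3 / sqrt (real n)"
      proof -
        have "sqrt (real n) ^ 3 = real n * sqrt (real n)" using n by (simp add: power3_eq_cube)
        then show ?thesis using n by (simp add: \<tau>_def N_def power_divide)
      qed
      have 2: "\<tau>\<^sup>2 * (2 * sqrt (real N)) = 2 * sqrt (real m) * T\<^sup>2 / sqrt (real n)"
      proof -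
        have "sqrt (real n) / real n = 1 / sqrt (real n)" using n by (simp add: field_simps)
        then show ?thesis using n by (simp add: \<tau>_def N_def power_divide real_sqrt_mult field_simps)
      qed
      show ?thesis unfolding B_def 1 2 using n by (simp add: \<tau>_def powr_half_sqrt algebra_simps)
    qed
    finally show ?case unfolding N_def .
  qed
  then have "(\<lambda>n. phi (n * m) (s / sqrt (real n)) (t / sqrt (real n)) - complex_of_real (exp (- cov_form s t / 2))) \<longlonglongrightarrow> 0"
    by (rule Lim_null_comparison[OF _ B])
  then show ?thesis by (rule LIM_zero_cancel)
qed

definition "normalized_counts n d =
  ((real (outdeg_count 0 n d) - (real m + 1) / (2 * real m + 1) * real n) / sqrt (real n),
   (real (outdeg_count 1 n d) - real m * (real m + 1) / ((3 * real m + 1) * (2 * real m + 1)) * real n) / sqrt (real n))"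

text \<open>After \<open>n * m\<close> choices no node is partly attached, so the correction in
  \<open>w1\<close> vanishes.\<close>

lemma normalized_counts_conv_w: "normalized_counts n d = (w1 (n * m) d / sqrt (real n), w2 (n * m) d / sqrt (real n))"
  using m by (simp add: normalized_counts_def w1_def w2_def)

lemma char_normalized_counts:
  "measure_pmf.expectation (map_pmf (normalized_counts n) (pa_circuit m n)) (\<lambda>x. cis (s * fst x + t * snd x))
    = phi (n * m) (s / sqrt (real n)) (t / sqrt (real n))"
  by (simp add: normalized_counts_conv_w pa_circuit_conv_chain phi_def)

lemma tail_normalized_counts:
  assumes "R > 0"
  shows "measure_pmf.prob (map_pmf (normalized_counts n) (pa_circuit m n)) {x. R < \<bar>fst x\<bar> \<or> R < \<bar>snd x\<bar>} \<le> 14 * real m / R\<^sup>2"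
proof (cases "n = 0")
  \<comment> \<open>Tightness is required for every \<open>n\<close>. At 0 the division by
    \<open>sqrt 0\<close> gives the pair (0, 0), whose tail is empty.\<close>
  case True
  then show ?thesis using assms by (simp add: normalized_counts_def vimage_def)
next
  case False
  define A where "A = {x :: real \<times> real. R < \<bar>fst x\<bar> \<or> R < \<bar>snd x\<bar>}"
  have "measure_pmf.prob (map_pmf (normalized_counts n) (pa_circuit m n)) A
     = measure_pmf.expectation (chain m (n * m)) (\<lambda>d. indicator A (normalized_counts n d))"
    by (simp add: pa_circuit_conv_chain indicator_vimage[symmetric])
  also have "\<dots> \<le> measure_pmf.expectation (chain m (n * m)) (\<lambda>d. ((w1 (n * m) d)\<^sup>2 + (w2 (n * m) d)\<^sup>2) / (real n * R\<^sup>2))"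
  proof (intro integral_mono integrable_chain)
    fix d
    have sq: "1 \<le> y\<^sup>2 / (real n * R\<^sup>2)" if "R < \<bar>y / sqrt (real n)\<bar>" for y
    proof -
      have "R\<^sup>2 \<le> (y / sqrt (real n))\<^sup>2" using that assms by (simp add: abs_le_square_iff[symmetric])
      then show ?thesis using assms False by (simp add: power_divide field_simps)
    qed
    have nn: "0 \<le> y\<^sup>2 / (real n * R\<^sup>2)" for y by simp
    show "indicator A (normalized_counts n d) \<le> ((w1 (n * m) d)\<^sup>2 + (w2 (n * m) d)\<^sup>2) / (real n * R\<^sup>2)"
      unfolding normalized_counts_conv_w A_def add_divide_distrib
      using sq[of "w1 (n * m) d"] sq[of "w2 (n * m) d"] nn[of "w1 (n * m) d"] nn[of "w2 (n * m) d"]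
      by (auto simp: indicator_def simp del: divide_nonneg_nonneg)
  qed
  also have "\<dots> \<le> (13 * real (n * m) + 1) / (real n * R\<^sup>2)"
    using second_moment[of "n * m"] by (simp add: divide_right_mono)
  also have "\<dots> \<le> (14 * real (n * m)) / (real n * R\<^sup>2)"
  proof (intro divide_right_mono)
    have "1 \<le> n * m" using False m by simp
    then have "1 \<le> real (n * m)" by linarith
    then show "13 * real (n * m) + 1 \<le> 14 * real (n * m)" by linarith
  qed auto
  also have "\<dots> = 14 * real m / R\<^sup>2" using False by simp
  finally show ?thesis unfolding A_def .
qed

lemma central_limit:
  "weak_conv_R2 (\<lambda>n. measure_pmf (map_pmf (normalized_counts n) (pa_circuit m n))) (bivariate_normal var0 cov01 var1)"
proof (rule weak_conv_R2I)
  show "prob_space (bivariate_normal var0 cov01 var1)"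
    by (rule prob_space_bivariate_normal[OF var0_pos cov_det_pos])
  show "(\<lambda>x. x) \<in> borel_measurable (bivariate_normal var0 cov01 var1)"
    unfolding bivariate_normal_def lborel_prod by simp
  show "(\<lambda>n. CLINT x|map_pmf (normalized_counts n) (pa_circuit m n). cis (s * fst x + t * snd x))
        \<longlonglongrightarrow> (CLINT x|bivariate_normal var0 cov01 var1. cis (s * fst x + t * snd x))" for s t
    unfolding char_normalized_counts bivariate_normal_char[OF var0_pos cov_det_pos]
    using phi_tendsto[of s t] unfolding cov_form_def .
  show "\<exists>R. \<forall>n. measure_pmf.prob (map_pmf (normalized_counts n) (pa_circuit m n))
      {x \<in> space (measure_pmf (map_pmf (normalized_counts n) (pa_circuit m n))). R < \<bar>fst x\<bar> \<or> R < \<bar>snd x\<bar>} \<le> e" if "e > 0" for e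
  proof (intro exI allI)
    fix n
    define R where "R = max 1 (14 * real m / e)"
    have R: "R \<ge> 1" "R \<ge> 14 * real m / e" by (auto simp: R_def)
    have "14 * real m / R\<^sup>2 \<le> 14 * real m / R"
      using R by (intro divide_left_mono) (auto simp: power2_eq_square)
    also have "\<dots> \<le> e" using R \<open>e > 0\<close> by (simp add: field_simps)
    finally show "measure_pmf.prob (map_pmf (normalized_counts n) (pa_circuit m n))
      {x \<in> space (measure_pmf (map_pmf (normalized_counts n) (pa_circuit m n))).
        max 1 (14 * real m / e) < \<bar>fst x\<bar> \<or> max 1 (14 * real m / e) < \<bar>snd x\<bar>} \<le> e"
      using tail_normalized_counts[of R n] R unfolding R_def by simp
  qed
qed (auto intro: prob_space_measure_pmf)

end

theorem theorem2:
  fixes m :: nat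
  assumes "m \<ge> 2"
  shows "weak_conv_R2
     (\<lambda>n. measure_pmf (map_pmf
        (\<lambda>d. ((real (outdeg_count 0 n d) - (m + 1) / (2 * m + 1) * n) / sqrt n,
              (real (outdeg_count 1 n d) - m * (m + 1) / ((3 * m + 1) * (2 * m + 1)) * n) / sqrt n))
        (pa_circuit m n)))
     (bivariate_normal
        (2 * m\<^sup>2 * (m + 1) / ((3 * m + 1) * (2 * m + 1)\<^sup>2))
        (- (4 * (m + 1)\<^sup>2 * m\<^sup>2 / ((4 * m + 1) * (3 * m + 1) * (2 * m + 1)\<^sup>2)))
        (2 * m\<^sup>2 * (m + 1) * (48 * m ^ 3 + 59 * m\<^sup>2 + 27 * m + 4)
           / ((5 * m + 1) * (4 * m + 1) * (3 * m + 1)\<^sup>2 * (2 * m + 1)\<^sup>2)))"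
proof -
  interpret circuit m by unfold_locales (use assms in simp)
  show ?thesis
    using central_limit unfolding normalized_counts_def[abs_def] var0_def cov01_def var1_def
    by (simp only: of_nat_add of_nat_mult of_nat_power of_nat_numeral of_nat_1)
qed

end
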